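(* Let $B$ be a smooth projective curve over $\mathbb{C}$ with function field $K=\mathbb{C}(B)$. Let $X$ be a projective variety over $K$ and $\pi:\mathcal{X}\to B$ an integral model of $X$. Let $D$ be an open subset of $B$ whose closure $\overline D$ is contained in an open disc $D'$ of $B$, and let $\omega$ be a real $(1,1)$-form on an open neighborhood of $\pi^{-1}(\overline D)$ in $\mathcal{X}$. Assume that the fiber $\mathcal{X}_b$ is Brody hyperbolic for every $b\in\overline D$. Then the partial height $h_{(D,\omega)}$ is bounded above on $X(K)$.
   Context: An integral model of $X$ over $B$ is an integral projective flat $\pi:\mathcal{X}\to B$ with generic fiber $X$; $X(K)=\mathcal{X}(B)$, so points are holomorphic sections $x:B\to\mathcal{X}$. Forms on singular analytic varieties are forms on the smooth locus locally extendable to ambient manifolds; real means $\overline\omega=\omega$. The partial height is $h_{(D,\omega)}(x)=\int_D x^*\omega$. Brody hyperbolic means no non-constant holomorphic map from $\mathbb{C}$. *)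

theory Defs
  imports "HOL-Complex_Analysis.Complex_Analysis" "HOL-Algebra.Ideal"
begin

section \<open>Complex projective space\<close>

definition proj_rel :: "complex^'n \<Rightarrow> complex^'n \<Rightarrow> bool" where
  "proj_rel v w \<longleftrightarrow> v \<noteq> 0 \<and> w \<noteq> 0 \<and> (\<exists>c. w = c *s v)"

lemma proj_rel_part_equivp: "part_equivp (proj_rel :: complex^'n \<Rightarrow> complex^'n \<Rightarrow> bool)"
proof (rule part_equivpI)
  have "proj_rel (1::complex^'n) 1"
    unfolding proj_rel_def by (auto intro: exI[of _ 1])
  then show "\<exists>v::complex^'n. proj_rel v v" by blast
  show "symp (proj_rel :: complex^'n \<Rightarrow> complex^'n \<Rightarrow> bool)"
  proof (rule sympI)
    fix v w :: "complex^'n"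
    assume "proj_rel v w"
    then obtain c where c: "v \<noteq> 0" "w \<noteq> 0" "w = c *s v" unfolding proj_rel_def by blast
    then have "c \<noteq> 0" by auto
    then have "v = inverse c *s w" using c by (simp add: vector_smult_assoc)
    then show "proj_rel w v" unfolding proj_rel_def using c by blast
  qed
  show "transp (proj_rel :: complex^'n \<Rightarrow> complex^'n \<Rightarrow> bool)"
    by (rule transpI) (auto simp: proj_rel_def vector_smult_assoc)
qed

text \<open>The type \<open>'n proj\<close> is the projective space of lines in \<open>complex^'n\<close>, of dimension
  \<open>CARD('n) - 1\<close>. It carries the classical (quotient) topology.\<close>

quotient_type 'n proj = "complex^'n" / partial: proj_rel
  by (rule proj_rel_part_equivp)

abbreviation pt :: "complex^'n \<Rightarrow> 'n proj" where
  "pt v \<equiv> abs_proj v"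

definition pcone :: "'n proj set \<Rightarrow> (complex^'n) set" where
  "pcone S = {v. v \<noteq> 0 \<and> pt v \<in> S}"

instantiation proj :: (finite) topological_space
begin

definition open_proj :: "'a proj set \<Rightarrow> bool" where
  "open_proj U \<longleftrightarrow> open (pcone U)"

instance
proof
  have "pcone (UNIV :: 'a proj set) = - {0}" by (auto simp: pcone_def)
  then show "open (UNIV :: 'a proj set)" by (simp add: open_proj_def open_Compl)
next
  fix S T :: "'a proj set"
  assume "open S" "open T"
  moreover have "pcone (S \<inter> T) = pcone S \<inter> pcone T" by (auto simp: pcone_def)
  ultimately show "open (S \<inter> T)" by (simp add: open_proj_def open_Int)
next
  fix K :: "'a proj set set"
  assume "\<forall>S\<in>K. open S"
  moreover have "pcone (\<Union>K) = (\<Union>S\<in>K. pcone S)" by (auto simp: pcone_def)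
  ultimately show "open (\<Union>K)" by (simp add: open_proj_def open_UN)
qed

end

type_synonym ('n, 'm) bivec = "(complex^'n) \<times> (complex^'m)"

definition bipt :: "('n::finite, 'm::finite) bivec \<Rightarrow> 'n proj \<times> 'm proj" where
  "bipt x = (pt (fst x), pt (snd x))"

definition bicone :: "('n::finite proj \<times> 'm::finite proj) set \<Rightarrow> ('n, 'm) bivec set" where
  "bicone S = {x. fst x \<noteq> 0 \<and> snd x \<noteq> 0 \<and> bipt x \<in> S}"

definition biscale :: "complex \<Rightarrow> complex \<Rightarrow> ('n::finite, 'm::finite) bivec \<Rightarrow> ('n, 'm) bivec" where
  "biscale s t x = (s *s fst x, t *s snd x)"


section \<open>Algebraic sets\<close>

definition exps :: "nat \<Rightarrow> ('n::finite \<Rightarrow> nat) set" where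
  "exps d = {a. (\<Sum>i\<in>UNIV. a i) = d}"

definition monomial :: "('n \<Rightarrow> nat) \<Rightarrow> complex^'n \<Rightarrow> complex" where
  "monomial a v = (\<Prod>i\<in>UNIV. (v $ i) ^ a i)"

definition form_poly :: "nat \<Rightarrow> (complex^'n \<Rightarrow> complex) \<Rightarrow> bool" where
  "form_poly d F \<longleftrightarrow> (\<exists>c. \<forall>v. F v = (\<Sum>a\<in>exps d. c a * monomial a v))"

definition biform_poly :: "nat \<Rightarrow> nat \<Rightarrow> (('n::finite, 'm::finite) bivec \<Rightarrow> complex) \<Rightarrow> bool" where
  "biform_poly d e F \<longleftrightarrow>
     (\<exists>c. \<forall>u v. F (u, v) = (\<Sum>a\<in>exps d. \<Sum>b\<in>exps e. c a b * monomial a u * monomial b v))"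

definition zclosed :: "'n::finite proj set \<Rightarrow> bool" where
  "zclosed S \<longleftrightarrow> (\<exists>Fs. (\<forall>F\<in>Fs. \<exists>d. form_poly d F) \<and>
     pcone S = {v \<in> pcone UNIV. \<forall>F\<in>Fs. F v = 0})"

definition bizclosed :: "('n::finite proj \<times> 'm::finite proj) set \<Rightarrow> bool" where
  "bizclosed S \<longleftrightarrow> (\<exists>Fs. (\<forall>F\<in>Fs. \<exists>d e. biform_poly d e F) \<and>
     bicone S = {x \<in> bicone UNIV. \<forall>F\<in>Fs. F x = 0})"

text \<open>In the next two definitions \<open>zc\<close> is the family of Zariski closed subsets of the ambient space.\<close>

definition irreducible_set :: "('p set \<Rightarrow> bool) \<Rightarrow> 'p set \<Rightarrow> bool" where
  "irreducible_set zc S \<longleftrightarrow> S \<noteq> {} \<and>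
     (\<forall>Z1 Z2. zc Z1 \<and> zc Z2 \<and> S \<subseteq> Z1 \<union> Z2 \<longrightarrow> S \<subseteq> Z1 \<or> S \<subseteq> Z2)"

definition krull_dim :: "('p set \<Rightarrow> bool) \<Rightarrow> 'p set \<Rightarrow> nat" where
  "krull_dim zc S = (GREATEST d. \<exists>Z. (\<forall>i\<le>d. zc (Z i) \<and> irreducible_set zc (Z i) \<and> Z i \<subseteq> S) \<and>
     (\<forall>i<d. Z i \<subset> Z (Suc i)))"

text \<open>Zariski tangent spaces of the affine cones; they contain the directions of the fibres of
  \<open>pt\<close> and \<open>bipt\<close>, hence the shifts by 1 and 2 in the smoothness conditions below. The
  operator \<open>dim\<close> is the real dimension.\<close>

definition tangent :: "'n proj set \<Rightarrow> complex^'n \<Rightarrow> (complex^'n) set" where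
  "tangent S v = {w. \<forall>d F. form_poly d F \<and> (\<forall>y\<in>pcone S. F y = 0) \<longrightarrow>
     frechet_derivative F (at v) w = 0}"

definition bitangent :: "('n::finite proj \<times> 'm::finite proj) set \<Rightarrow> ('n, 'm) bivec \<Rightarrow> ('n, 'm) bivec set" where
  "bitangent S x = {w. \<forall>d e F. biform_poly d e F \<and> (\<forall>y\<in>bicone S. F y = 0) \<longrightarrow>
     frechet_derivative F (at x) w = 0}"

definition smooth_projective_curve :: "'m::finite proj set \<Rightarrow> bool" where
  "smooth_projective_curve B \<longleftrightarrow> zclosed B \<and> irreducible_set zclosed B \<and>
     krull_dim zclosed B = 1 \<and> (\<forall>v\<in>pcone B. dim (tangent B v) = 2 * (1 + 1))"

definition smooth_locus :: "('n::finite proj \<times> 'm::finite proj) set \<Rightarrow> ('n proj \<times> 'm proj) set" where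
  "smooth_locus S = {p \<in> S. \<forall>x\<in>bicone {p}. dim (bitangent S x) = 2 * (krull_dim bizclosed S + 2)}"


section \<open>Regular functions, function field, flatness\<close>

definition regular_at :: "'m::finite proj set \<Rightarrow> 'm proj \<Rightarrow> ('m proj \<Rightarrow> complex) \<Rightarrow> bool" where
  "regular_at S p f \<longleftrightarrow> (\<exists>d F G. form_poly d F \<and> form_poly d G \<and> (\<forall>v\<in>pcone {p}. G v \<noteq> 0) \<and>
     (\<forall>v\<in>pcone S. G v \<noteq> 0 \<longrightarrow> f (pt v) = F v / G v))"

definition biregular_at ::
  "('n::finite proj \<times> 'm::finite proj) set \<Rightarrow> 'n proj \<times> 'm proj \<Rightarrow> ('n proj \<times> 'm proj \<Rightarrow> complex) \<Rightarrow> bool" where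
  "biregular_at S p f \<longleftrightarrow> (\<exists>d e F G. biform_poly d e F \<and> biform_poly d e G \<and>
     (\<forall>x\<in>bicone {p}. G x \<noteq> 0) \<and> (\<forall>x\<in>bicone S. G x \<noteq> 0 \<longrightarrow> f (bipt x) = F x / G x))"

definition germ_eq :: "('p set \<Rightarrow> bool) \<Rightarrow> 'p set \<Rightarrow> 'p \<Rightarrow> ('p \<Rightarrow> complex) \<Rightarrow> ('p \<Rightarrow> complex) \<Rightarrow> bool" where
  "germ_eq zc S p f g \<longleftrightarrow> (\<exists>Z. zc Z \<and> p \<notin> Z \<and> (\<forall>q\<in>S - Z. f q = g q))"

text \<open>Flatness of the local ring of \<open>S\<close> at \<open>p\<close> over the local ring of \<open>B\<close> at \<open>snd p\<close>, for every
  \<open>p\<close>, by the equational criterion: every linear relation with coefficients in the base ring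
  is a consequence of relations in the base ring. Germs are represented by functions.\<close>

definition flat_over :: "'m::finite proj set \<Rightarrow> ('n::finite proj \<times> 'm proj) set \<Rightarrow> bool" where
  "flat_over B S \<longleftrightarrow> (\<forall>p\<in>S. \<forall>(k::nat) r m.
     (\<forall>i<k. regular_at B (snd p) (r i) \<and> biregular_at S p (m i)) \<and>
     germ_eq bizclosed S p (\<lambda>q. \<Sum>i<k. r i (snd q) * m i q) (\<lambda>_. 0) \<longrightarrow>
     (\<exists>(l::nat) a y.
        (\<forall>j<l. biregular_at S p (y j)) \<and>
        (\<forall>i<k. \<forall>j<l. regular_at B (snd p) (a i j)) \<and>
        (\<forall>i<k. germ_eq bizclosed S p (m i) (\<lambda>q. \<Sum>j<l. a i j (snd q) * y j q)) \<and>
        (\<forall>j<l. germ_eq zclosed B (snd p) (\<lambda>b. \<Sum>i<k. r i b * a i j b) (\<lambda>_. 0))))"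

text \<open>An element of the function field is the class of all functions that represent a given
  rational function on some nonempty Zariski open subset of \<open>B\<close>.\<close>

definition rational_fun :: "'m::finite proj set \<Rightarrow> ('m proj \<Rightarrow> complex) \<Rightarrow> bool" where
  "rational_fun B f \<longleftrightarrow> (\<exists>p\<in>B. regular_at B p f)"

definition gen_eq :: "'m::finite proj set \<Rightarrow> ('m proj \<Rightarrow> complex) \<Rightarrow> ('m proj \<Rightarrow> complex) \<Rightarrow> bool" where
  "gen_eq B f g \<longleftrightarrow> (\<exists>p\<in>B. germ_eq zclosed B p f g)"

definition rat_class :: "'m::finite proj set \<Rightarrow> ('m proj \<Rightarrow> complex) \<Rightarrow> ('m proj \<Rightarrow> complex) set" where
  "rat_class B f = {g. rational_fun B g \<and> gen_eq B f g}"

definition function_field :: "'m::finite proj set \<Rightarrow> ('m proj \<Rightarrow> complex) set ring" where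
  "function_field B = \<lparr>
     carrier = {rat_class B f | f. rational_fun B f},
     monoid.mult = (\<lambda>P Q. {h. rational_fun B h \<and> (\<exists>f\<in>P. \<exists>g\<in>Q. gen_eq B (\<lambda>b. f b * g b) h)}),
     one = rat_class B (\<lambda>_. 1),
     zero = rat_class B (\<lambda>_. 0),
     add = (\<lambda>P Q. {h. rational_fun B h \<and> (\<exists>f\<in>P. \<exists>g\<in>Q. gen_eq B (\<lambda>b. f b + g b) h)})\<rparr>"


section \<open>Projective varieties over a field and their rational points\<close>

definition mpoly_ring :: "('k, 'x) ring_scheme \<Rightarrow> (('n::finite \<Rightarrow> nat) \<Rightarrow> 'k) ring" where
  "mpoly_ring K = \<lparr>
     carrier = {P. (\<forall>a. P a \<in> carrier K) \<and> finite {a. P a \<noteq> \<zero>\<^bsub>K\<^esub>}},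
     monoid.mult = (\<lambda>P Q a. \<Oplus>\<^bsub>K\<^esub>b\<in>{b. \<forall>i. b i \<le> a i}. P b \<otimes>\<^bsub>K\<^esub> Q (\<lambda>i. a i - b i)),
     one = (\<lambda>a. if a = (\<lambda>_. 0) then \<one>\<^bsub>K\<^esub> else \<zero>\<^bsub>K\<^esub>),
     zero = (\<lambda>_. \<zero>\<^bsub>K\<^esub>),
     add = (\<lambda>P Q a. P a \<oplus>\<^bsub>K\<^esub> Q a)\<rparr>"

definition mpoly_var :: "('k, 'x) ring_scheme \<Rightarrow> 'n::finite \<Rightarrow> ('n \<Rightarrow> nat) \<Rightarrow> 'k" where
  "mpoly_var K i = (\<lambda>a. if a = (\<lambda>j. if j = i then 1 else 0) then \<one>\<^bsub>K\<^esub> else \<zero>\<^bsub>K\<^esub>)"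

definition mpoly_eval :: "('k, 'x) ring_scheme \<Rightarrow> (('n::finite \<Rightarrow> nat) \<Rightarrow> 'k) \<Rightarrow> ('n \<Rightarrow> 'k) \<Rightarrow> 'k" where
  "mpoly_eval K P \<xi> =
     (\<Oplus>\<^bsub>K\<^esub>a\<in>{a. P a \<noteq> \<zero>\<^bsub>K\<^esub>}. P a \<otimes>\<^bsub>K\<^esub> (\<Otimes>\<^bsub>K\<^esub>i\<in>UNIV. \<xi> i [^]\<^bsub>K\<^esub> a i))"

text \<open>An integral closed subscheme of projective space over \<open>K\<close> is given by its homogeneous
  prime ideal, which does not contain the irrelevant ideal.\<close>

definition projective_variety :: "('k, 'x) ring_scheme \<Rightarrow> (('n::finite \<Rightarrow> nat) \<Rightarrow> 'k) set \<Rightarrow> bool" where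
  "projective_variety K X \<longleftrightarrow> primeideal X (mpoly_ring K) \<and>
     (\<forall>P\<in>X. \<forall>d. (\<lambda>a. if a \<in> exps d then P a else \<zero>\<^bsub>K\<^esub>) \<in> X) \<and>
     (\<exists>i. mpoly_var K i \<notin> X)"

definition rational_points :: "('k, 'x) ring_scheme \<Rightarrow> (('n::finite \<Rightarrow> nat) \<Rightarrow> 'k) set \<Rightarrow> ('n \<Rightarrow> 'k) set set" where
  "rational_points K X =
     {{(\<lambda>i. c \<otimes>\<^bsub>K\<^esub> \<xi> i) | c. c \<in> carrier K \<and> c \<noteq> \<zero>\<^bsub>K\<^esub>} | \<xi>.
        (\<forall>i. \<xi> i \<in> carrier K) \<and> (\<exists>i. \<xi> i \<noteq> \<zero>\<^bsub>K\<^esub>) \<and> (\<forall>P\<in>X. mpoly_eval K P \<xi> = \<zero>\<^bsub>K\<^esub>)}"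


section \<open>Integral models\<close>

text \<open>The homogeneous ideal of the generic fibre: polynomials over the function field that
  vanish on the part of the model above some nonempty Zariski open subset of \<open>B\<close>.\<close>

definition generic_fibre ::
  "'m::finite proj set \<Rightarrow> ('n::finite proj \<times> 'm proj) set \<Rightarrow> (('n \<Rightarrow> nat) \<Rightarrow> ('m proj \<Rightarrow> complex) set) set" where
  "generic_fibre B S = {P \<in> carrier (mpoly_ring (function_field B)).
     \<exists>f Z. (\<forall>a. f a \<in> P a) \<and> zclosed Z \<and> \<not> B \<subseteq> Z \<and>
       (\<forall>b\<in>B - Z. \<forall>u. u \<noteq> 0 \<and> (pt u, b) \<in> S \<longrightarrow>
          (\<Sum>a\<in>{a. P a \<noteq> \<zero>\<^bsub>function_field B\<^esub>}. f a b * monomial a u) = 0)}"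

text \<open>A projective morphism to \<open>B\<close> is the restriction of the second projection to a closed
  subset of the product of a projective space with \<open>B\<close>; integral schemes over the complex
  numbers are represented by their closed points.\<close>

definition integral_model ::
  "'m::finite proj set \<Rightarrow> (('n::finite \<Rightarrow> nat) \<Rightarrow> ('m proj \<Rightarrow> complex) set) set \<Rightarrow> ('n proj \<times> 'm proj) set \<Rightarrow> bool" where
  "integral_model B X S \<longleftrightarrow> S \<subseteq> UNIV \<times> B \<and> bizclosed S \<and> irreducible_set bizclosed S \<and>
     flat_over B S \<and> generic_fibre B S = X"


section \<open>Holomorphic maps\<close>

definition vec_holomorphic_on :: "(complex \<Rightarrow> complex^'n) \<Rightarrow> complex set \<Rightarrow> bool" where
  "vec_holomorphic_on G N \<longleftrightarrow> (\<forall>i. (\<lambda>t. G t $ i) holomorphic_on N)"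

definition proj_holomorphic_on :: "(complex \<Rightarrow> 'n::finite proj) \<Rightarrow> complex set \<Rightarrow> bool" where
  "proj_holomorphic_on f S \<longleftrightarrow> (\<forall>z\<in>S. \<exists>N G. open N \<and> z \<in> N \<and> vec_holomorphic_on G N \<and>
     (\<forall>t\<in>N. G t \<noteq> 0) \<and> (\<forall>t\<in>N \<inter> S. f t = pt (G t)))"

definition brody_hyperbolic :: "'n::finite proj set \<Rightarrow> bool" where
  "brody_hyperbolic Y \<longleftrightarrow>
     (\<forall>f. proj_holomorphic_on f UNIV \<and> range f \<subseteq> Y \<longrightarrow> f constant_on UNIV)"

definition mv_holomorphic_on :: "(complex^'m \<Rightarrow> complex) \<Rightarrow> (complex^'m) set \<Rightarrow> bool" where
  "mv_holomorphic_on g N \<longleftrightarrow>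
     (\<forall>v\<in>N. \<exists>g'. (g has_derivative g') (at v) \<and> (\<forall>c w. g' (c *s w) = c * g' w))"

text \<open>Holomorphy on subsets of projective space means local extendability to the ambient space,
  expressed on cones.\<close>

definition fun_holomorphic_on :: "('m::finite proj \<Rightarrow> complex) \<Rightarrow> 'm proj set \<Rightarrow> bool" where
  "fun_holomorphic_on g S \<longleftrightarrow> (\<forall>v\<in>pcone S. \<exists>N h. open N \<and> v \<in> N \<and> mv_holomorphic_on h N \<and>
     (\<forall>y\<in>N \<inter> pcone S. g (pt y) = h y))"

definition map_holomorphic_on :: "('m::finite proj \<Rightarrow> 'n::finite proj) \<Rightarrow> 'm proj set \<Rightarrow> bool" where
  "map_holomorphic_on f S \<longleftrightarrow> (\<forall>v\<in>pcone S. \<exists>N G. open N \<and> v \<in> N \<and>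
     (\<forall>i. mv_holomorphic_on (\<lambda>y. G y $ i) N) \<and> (\<forall>y\<in>N. G y \<noteq> 0) \<and>
     (\<forall>y\<in>N \<inter> pcone S. f (pt y) = pt (G y)))"

definition disc_chart :: "'m::finite proj set \<Rightarrow> (complex \<Rightarrow> 'm proj) \<Rightarrow> bool" where
  "disc_chart B \<psi> \<longleftrightarrow> proj_holomorphic_on \<psi> (ball 0 1) \<and> inj_on \<psi> (ball 0 1) \<and>
     openin (top_of_set B) (\<psi> ` ball 0 1) \<and>
     fun_holomorphic_on (inv_into (ball 0 1) \<psi>) (\<psi> ` ball 0 1)"

definition open_disc :: "'m::finite proj set \<Rightarrow> 'm proj set \<Rightarrow> bool" where
  "open_disc B D \<longleftrightarrow> (\<exists>\<psi>. disc_chart B \<psi> \<and> \<psi> ` ball 0 1 = D)"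

definition holomorphic_section ::
  "'m::finite proj set \<Rightarrow> ('n::finite proj \<times> 'm proj) set \<Rightarrow> ('m proj \<Rightarrow> 'n proj \<times> 'm proj) \<Rightarrow> bool" where
  "holomorphic_section B S x \<longleftrightarrow>
     (\<forall>b\<in>B. x b \<in> S \<and> snd (x b) = b) \<and> map_holomorphic_on (fst \<circ> x) B"

text \<open>The holomorphic section extending a rational point of the generic fibre; by the valuative
  criterion of properness it exists and is unique on \<open>B\<close>.\<close>

definition section_of_point ::
  "'m::finite proj set \<Rightarrow> ('n proj \<times> 'm proj) set \<Rightarrow> ('n::finite \<Rightarrow> ('m proj \<Rightarrow> complex) set) set \<Rightarrow>
     'm proj \<Rightarrow> 'n proj \<times> 'm proj" where
  "section_of_point B S \<Xi> = (SOME x. holomorphic_section B S x \<and>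
     (\<exists>\<xi>\<in>\<Xi>. \<exists>f Z. (\<forall>i. f i \<in> \<xi> i) \<and> zclosed Z \<and> \<not> B \<subseteq> Z \<and>
       (\<forall>b\<in>B - Z. (\<chi> i. f i b) \<noteq> 0 \<and> x b = (pt (\<chi> i. f i b), b))))"


section \<open>Differential forms\<close>

primrec Ck_on :: "nat \<Rightarrow> ('a::euclidean_space \<Rightarrow> complex) \<Rightarrow> 'a set \<Rightarrow> bool" where
  "Ck_on 0 f S = continuous_on S f"
| "Ck_on (Suc k) f S =
     (\<exists>f'. (\<forall>x\<in>S. (f has_derivative f' x) (at x)) \<and> (\<forall>v. Ck_on k (\<lambda>x. f' x v) S))"

type_synonym ('n, 'm) two_form =
  "('n, 'm) bivec \<Rightarrow> ('n, 'm) bivec \<Rightarrow> ('n, 'm) bivec \<Rightarrow> complex"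

text \<open>A complex-valued smooth form of type (1,1) on an open subset \<open>U\<close> of a product of two
  projective spaces, represented by its pull-back to the cone over \<open>U\<close>. The pull-backs are
  exactly the forms which are invariant under scaling and vanish on the directions of the fibres
  of \<open>bipt\<close>. A 2-form has type (1,1) iff it is invariant under multiplication of both arguments
  by the imaginary unit.\<close>

definition smooth_11_form :: "('n::finite proj \<times> 'm::finite proj) set \<Rightarrow> ('n, 'm) two_form \<Rightarrow> bool" where
  "smooth_11_form U \<Omega> \<longleftrightarrow> open U \<and>
     (\<forall>x\<in>bicone U. bilinear (\<Omega> x) \<and> (\<forall>w. \<Omega> x w w = 0) \<and>
        (\<forall>w w'. \<Omega> x (biscale \<i> \<i> w) (biscale \<i> \<i> w') = \<Omega> x w w') \<and>
        (\<forall>s t w. \<Omega> x (biscale s t x) w = 0) \<and>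
        (\<forall>s t w w'. s \<noteq> 0 \<and> t \<noteq> 0 \<longrightarrow>
           \<Omega> (biscale s t x) (biscale s t w) (biscale s t w') = \<Omega> x w w')) \<and>
     (\<forall>w w' k. Ck_on k (\<lambda>x. \<Omega> x w w') (bicone U))"

definition extends_form ::
  "('n::finite proj \<times> 'm::finite proj) set \<Rightarrow> ('n proj \<times> 'm proj) set \<Rightarrow> ('n, 'm) two_form \<Rightarrow> ('n, 'm) two_form \<Rightarrow> bool" where
  "extends_form S V \<Omega> \<omega> \<longleftrightarrow> (\<forall>x\<in>bicone (smooth_locus S \<inter> V).
     \<forall>w\<in>bitangent S x. \<forall>w'\<in>bitangent S x. \<Omega> x w w' = \<omega> x w w')"

text \<open>Only the values of \<open>\<omega>\<close> at smooth points of \<open>S\<close> in \<open>W\<close> and on vectors tangent to \<open>S\<close>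
  are meaningful.\<close>

definition real_11_form_on ::
  "('n::finite proj \<times> 'm::finite proj) set \<Rightarrow> ('n proj \<times> 'm proj) set \<Rightarrow> ('n, 'm) two_form \<Rightarrow> bool" where
  "real_11_form_on S W \<omega> \<longleftrightarrow>
     (\<forall>p\<in>W. \<exists>U \<Omega>. p \<in> U \<and> smooth_11_form U \<Omega> \<and> extends_form S (U \<inter> W) \<Omega> \<omega>) \<and>
     (\<forall>x\<in>bicone (smooth_locus S \<inter> W). \<forall>w\<in>bitangent S x. \<forall>w'\<in>bitangent S x.
        cnj (\<omega> x w w') = \<omega> x w w')"


section \<open>Partial heights\<close>

definition hol_lift :: "(complex \<Rightarrow> 'n::finite proj \<times> 'm::finite proj) \<Rightarrow> complex \<Rightarrow> (complex \<Rightarrow> ('n, 'm) bivec) \<Rightarrow> bool" where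
  "hol_lift \<gamma> z G \<longleftrightarrow> (\<exists>N. open N \<and> z \<in> N \<and>
     vec_holomorphic_on (fst \<circ> G) N \<and> vec_holomorphic_on (snd \<circ> G) N \<and>
     (\<forall>t\<in>N. fst (G t) \<noteq> 0 \<and> snd (G t) \<noteq> 0 \<and> \<gamma> t = bipt (G t)))"

text \<open>The coefficient of the pull-back of \<open>\<Omega>\<close> by the holomorphic curve \<open>\<gamma>\<close> with respect to
  \<open>dRe z \<and> dIm z\<close>; it does not depend on the lift.\<close>

definition pullback_density :: "('n::finite, 'm::finite) two_form \<Rightarrow> (complex \<Rightarrow> 'n proj \<times> 'm proj) \<Rightarrow> complex \<Rightarrow> complex" where
  "pullback_density \<Omega> \<gamma> z =
     (let G = (SOME G. hol_lift \<gamma> z G);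
          w = (\<chi> i. deriv (\<lambda>t. fst (G t) $ i) z, \<chi> j. deriv (\<lambda>t. snd (G t) $ j) z)
      in \<Omega> (G z) w (biscale \<i> \<i> w))"

text \<open>A section may run inside the singular locus, where its pull-back of \<open>\<omega>\<close> is that of any
  local extension of \<open>\<omega>\<close> (the result does not depend on the extension). For this we fix finitely
  many local extensions, each on a neighbourhood of a compact set, such that the compact sets cover
  \<open>C\<close>; at a given point the first applicable extension is used.\<close>

definition extension_cover ::
  "('n::finite proj \<times> 'm::finite proj) set \<Rightarrow> ('n proj \<times> 'm proj) set \<Rightarrow> ('n, 'm) two_form \<Rightarrow>
     (('n proj \<times> 'm proj) set \<times> ('n, 'm) two_form) list \<Rightarrow> bool" where
  "extension_cover S C \<omega> L \<longleftrightarrow>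
     (\<forall>(Q, \<Omega>)\<in>set L. compact Q \<and> (\<exists>U. Q \<subseteq> U \<and> smooth_11_form U \<Omega> \<and> extends_form S U \<Omega> \<omega>)) \<and>
     C \<subseteq> (\<Union>(Q, \<Omega>)\<in>set L. Q)"

definition extension_at ::
  "('n::finite proj \<times> 'm::finite proj) set \<Rightarrow> ('n proj \<times> 'm proj) set \<Rightarrow> ('n, 'm) two_form \<Rightarrow> 'n proj \<times> 'm proj \<Rightarrow>
     ('n, 'm) two_form" where
  "extension_at S C \<omega> p =
     snd (hd (filter (\<lambda>(Q, \<Omega>). p \<in> Q) (SOME L. extension_cover S C \<omega> L)))"

definition height_integral ::
  "'m::finite proj set \<Rightarrow> ('n::finite proj \<times> 'm proj) set \<Rightarrow> 'm proj set \<Rightarrow> ('n, 'm) two_form \<Rightarrow>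
     ('m proj \<Rightarrow> 'n proj \<times> 'm proj) \<Rightarrow> real" where
  "height_integral B S D \<omega> x =
     (let \<psi> = (SOME \<psi>. disc_chart B \<psi> \<and> closure D \<subseteq> \<psi> ` ball 0 1)
      in LINT z:{z \<in> ball 0 1. \<psi> z \<in> D}|lborel.
           Re (pullback_density
             (extension_at S {q \<in> S. snd q \<in> closure D} \<omega> (x (\<psi> z))) (x \<circ> \<psi>) z))"

definition partial_height ::
  "'m::finite proj set \<Rightarrow> ('n::finite proj \<times> 'm proj) set \<Rightarrow> 'm proj set \<Rightarrow> ('n, 'm) two_form \<Rightarrow>
     ('n \<Rightarrow> ('m proj \<Rightarrow> complex) set) set \<Rightarrow> real" where
  "partial_height B S D \<omega> \<Xi> = height_integral B S D \<omega> (section_of_point B S \<Xi>)"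

end

theory Submission
  imports Defs
begin

text \<open>A bound for the pull-back density of \<open>\<omega>\<close> along sections follows from a bound for their
  Fubini--Study speed on the compact preimage of \<open>closure D\<close> in the coordinate disc, since the
  finitely many local extensions of \<open>\<omega>\<close> are bounded on compact sets. If the speeds were
  unbounded, rescaling at points maximising speed times distance to the boundary of shrinking discs
  would give maps with speed at most 2 on growing discs and speed 1 at the origin. Embedding
  projective space into the matrices by \<open>u \<mapsto> u u\<^sup>* / |u|\<^sup>2\<close> turns the speed bound into a
  Lipschitz bound, so by Arzela--Ascoli a subsequence converges to an entire curve, which has speed 1
  at the origin and lies in one fibre over \<open>closure D\<close>, contradicting hyperbolicity.\<close>

section \<open>Topology of projective space and its cones\<close>

text \<open>The type \<open>proj\<close> carries only a topology, so the analysis is done upstairs: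
  compactness comes from unit vectors, forms and tangent vectors live on the cone, and the
  quantities that matter do not change when a lift is rescaled. Speed is the right quantity to bound
  because a (1,1)-form that vanishes along the fibres of \<open>bipt\<close> is dominated by squared
  Fubini--Study lengths; the height is then at most a constant times the area of the unit disc. The
  embedding by matrices involves conjugation, so it yields equicontinuity and limits but no
  holomorphy. Holomorphy is recovered in affine coordinates, which are quotients of matrix entries.
  There Weierstrass' theorem on uniform limits applies, and the convergence of derivatives that it
  gives carries speed 1 over to the limit and so rules out a constant curve. The bound has to be
  uniform over all sections; the chart and the local extensions are therefore fixed before any
  section is considered.\<close>

lemma pt_eq_iff:
  assumes "v \<noteq> 0" "w \<noteq> 0"
  shows "pt v = pt w \<longleftrightarrow> (\<exists>c. w = c *s v)"
proof -
  have refl: "proj_rel u u" if "u \<noteq> 0" for u :: "complex^'a"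
    using that by (auto simp: proj_rel_def intro: exI[of _ 1])
  have "pt v = pt w \<longleftrightarrow> proj_rel v w"
    using Quotient_rel_abs2[OF Quotient_proj] Quotient_rel[OF Quotient_proj, of v w] refl assms by metis
  then show ?thesis using assms by (simp add: proj_rel_def)
qed

lemma pt_scale:
  assumes "c \<noteq> 0" "v \<noteq> 0"
  shows "pt (c *s v) = pt v"
proof -
  have "c *s v \<noteq> 0" using assms by (simp add: vec_eq_iff)
  with pt_eq_iff[of v "c *s v"] assms show ?thesis by auto
qed

lemma pt_surj: "\<exists>v. v \<noteq> 0 \<and> p = pt v"
proof -
  have "proj_rel (rep_proj p) (rep_proj p)"
    using Quotient_rep_reflp[OF Quotient_proj] .
  moreover have "pt (rep_proj p) = p" using Quotient_abs_rep[OF Quotient_proj] .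
  ultimately show ?thesis by (metis proj_rel_def)
qed

lemma pt_surj_unit: "\<exists>v. norm v = 1 \<and> p = pt v" for p :: "'n::finite proj"
proof -
  obtain v where v: "v \<noteq> 0" "p = pt v" using pt_surj by blast
  let ?w = "complex_of_real (1 / norm v) *s v"
  have "?w = (1 / norm v) *\<^sub>R v" unfolding vec_eq_iff by (simp add: scaleR_conv_of_real[where 'a=complex])
  then have "norm ?w = 1" using v by simp
  moreover have "p = pt ?w" using v by (subst pt_scale) auto
  ultimately show ?thesis by blast
qed

lemma open_pcone_iff: "open U \<longleftrightarrow> open (pcone U)" for U :: "'n::finite proj set"
  by (simp add: open_proj_def)

lemma continuous_on_pt: "continuous_on (- {0}) (pt :: complex^'n::finite \<Rightarrow> 'n proj)"
proof -
  have "open ((- {0}) \<inter> pt -` U)" if "open U" for U :: "'n proj set"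
  proof -
    have "(- {0}) \<inter> pt -` U = pcone U" by (auto simp: pcone_def)
    then show ?thesis using that by (simp add: open_pcone_iff)
  qed
  then show ?thesis
    by (subst continuous_on_open_vimage) (auto simp: open_Compl Int_commute)
qed

lemma continuous_on_smult: "continuous_on UNIV (\<lambda>v::complex^'n. c *s v)"
  unfolding vector_scalar_mult_def by (intro continuous_intros)

text \<open>The cone over the image is the union of the preimages of \<open>V\<close> under all
  nonzero scalings, and each of these is open.\<close>

lemma open_pt_image:
  fixes V :: "(complex^'n::finite) set"
  assumes "open V" "0 \<notin> V"
  shows "open (pt ` V)"
proof -
  have "pcone (pt ` V) = (\<Union>c\<in>-{0}. (\<lambda>v. c *s v) -` V)"
  proof (intro equalityI subsetI)
    fix v assume "v \<in> pcone (pt ` V)"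
    then obtain w where w: "v \<noteq> 0" "w \<in> V" "pt v = pt w" by (auto simp: pcone_def)
    then have "w \<noteq> 0" using assms by auto
    then obtain c where c: "w = c *s v" using w pt_eq_iff by blast
    then have "c \<noteq> 0" using \<open>w \<noteq> 0\<close> by auto
    then show "v \<in> (\<Union>c\<in>-{0}. (\<lambda>v. c *s v) -` V)" using c w by auto
  next
    fix v assume "v \<in> (\<Union>c\<in>-{0}. (\<lambda>v. c *s v) -` V)"
    then obtain c where c: "c \<noteq> 0" "c *s v \<in> V" by auto
    then have "v \<noteq> 0" using assms by auto
    then show "v \<in> pcone (pt ` V)" using c pt_scale[of c v] by (auto simp: pcone_def intro!: image_eqI[of _ _ "c *s v"])
  qed
  moreover have "open ((\<lambda>v. c *s v) -` V)" for c
    using continuous_on_smult[of c] assms(1) by (metis continuous_on_open_vimage open_UNIV Int_UNIV_right)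
  ultimately show ?thesis by (auto simp: open_pcone_iff)
qed

lemma mem_bicone: "x \<in> bicone S \<longleftrightarrow> fst x \<noteq> 0 \<and> snd x \<noteq> 0 \<and> (pt (fst x), pt (snd x)) \<in> S"
  by (simp add: bicone_def bipt_def)

lemma open_bicone_UNIV: "open (bicone UNIV :: ('n::finite, 'm::finite) bivec set)"
proof -
  have "(bicone UNIV :: ('n, 'm) bivec set) = (- {0}) \<times> (- {0} :: (complex^'m) set)" by (auto simp: mem_bicone)
  moreover have "open ((- {0}) \<times> (- {0} :: (complex^'m) set) :: ('n, 'm) bivec set)"
    by (intro open_Times open_Compl) auto
  ultimately show ?thesis by simp
qed

lemma continuous_on_bipt: "continuous_on (bicone UNIV) (bipt :: ('n::finite, 'm::finite) bivec \<Rightarrow> _)"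
  unfolding bipt_def
  by (intro continuous_on_Pair continuous_on_compose2[OF continuous_on_pt] continuous_intros)
     (auto simp: mem_bicone)

lemma open_bicone:
  fixes U :: "('n::finite proj \<times> 'm::finite proj) set"
  assumes "open U"
  shows "open (bicone U)"
proof -
  have "bicone U = bipt -` U \<inter> bicone UNIV" by (auto simp: bicone_def)
  then show ?thesis
    using continuous_on_bipt assms open_bicone_UNIV by (metis continuous_on_open_vimage)
qed

lemma open_bipt_image:
  fixes V :: "('n::finite, 'm::finite) bivec set"
  assumes "open V" "V \<subseteq> bicone UNIV"
  shows "open (bipt ` V)"
proof (rule open_prod_intro)
  fix p assume "p \<in> bipt ` V"
  then obtain x where x: "x \<in> V" "p = bipt x" by blast
  obtain A B where AB: "open A" "open B" "x \<in> A \<times> B" "A \<times> B \<subseteq> V"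
    using assms(1) x open_prod_elim by blast
  have "0 \<notin> A" "0 \<notin> B" using AB assms(2) by (fastforce simp: mem_bicone)+
  then have "open (pt ` A)" "open (pt ` B)" using AB open_pt_image by blast+
  moreover have "p \<in> pt ` A \<times> pt ` B" using x AB by (auto simp: bipt_def)
  moreover have "pt ` A \<times> pt ` B \<subseteq> bipt ` V"
    using AB(4) by (force simp: bipt_def image_iff)
  ultimately show "\<exists>A B. open A \<and> open B \<and> p \<in> A \<times> B \<and> A \<times> B \<subseteq> bipt ` V" by blast
qed

lemma biscale_simps [simp]:
  "fst (biscale s t x) = s *s fst x" "snd (biscale s t x) = t *s snd x"
  by (simp_all add: biscale_def)

lemma bipt_eq_imp_biscale:
  assumes "x \<in> bicone UNIV" "y \<in> bicone UNIV" "bipt x = bipt y"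
  obtains s t where "s \<noteq> 0" "t \<noteq> 0" "x = biscale s t y"
proof -
  have nz: "fst x \<noteq> 0" "snd x \<noteq> 0" "fst y \<noteq> 0" "snd y \<noteq> 0" using assms by (auto simp: mem_bicone)
  have "pt (fst y) = pt (fst x)" "pt (snd y) = pt (snd x)" using assms by (auto simp: bipt_def)
  then obtain s t where "fst x = s *s fst y" "snd x = t *s snd y" using pt_eq_iff nz by metis
  then show ?thesis using nz that[of s t] by (auto simp: prod_eq_iff)
qed

lemma biform_poly_continuous: "biform_poly d e F \<Longrightarrow> continuous_on A F"
proof -
  assume "biform_poly d e F"
  then obtain c where c: "\<And>u v. F (u, v) = (\<Sum>a\<in>exps d. \<Sum>b\<in>exps e. c a b * monomial a u * monomial b v)"
    by (auto simp: biform_poly_def)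
  then have "F = (\<lambda>x. \<Sum>a\<in>exps d. \<Sum>b\<in>exps e. c a b * monomial a (fst x) * monomial b (snd x))"
    by (metis prod.collapse ext)
  then show ?thesis by (auto simp: monomial_def intro!: continuous_intros)
qed

text \<open>Bihomogeneous polynomials are continuous. The limit must be assumed to lie in
  \<open>bicone UNIV\<close>, since vectors of the cone may tend to zero; membership is asked only
  eventually, because the lifts of convergent sequences used later exist only from some index
  on.\<close>

lemma bizclosed_limit:
  fixes S :: "('n::finite proj \<times> 'm::finite proj) set"
  assumes "bizclosed S" "\<forall>\<^sub>F k in sequentially. y k \<in> bicone S" "y \<longlonglongrightarrow> x" "x \<in> bicone UNIV"
  shows "x \<in> bicone S"
proof -
  obtain Fs where Fs: "\<forall>F\<in>Fs. \<exists>d e. biform_poly d e F" "bicone S = {x \<in> bicone UNIV. \<forall>F\<in>Fs. F x = 0}"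
    using assms(1) by (auto simp: bizclosed_def)
  have "F x = 0" if "F \<in> Fs" for F
  proof -
    have "continuous_on UNIV F" using Fs(1) that biform_poly_continuous by blast
    then have "(\<lambda>k. F (y k)) \<longlonglongrightarrow> F x"
      using assms(3) by (rule continuous_on_tendsto_compose) auto
    moreover have "\<forall>\<^sub>F k in sequentially. F (y k) = 0"
      using assms(2) by eventually_elim (use Fs(2) that in blast)
    then have "(\<lambda>k. F (y k)) \<longlonglongrightarrow> 0" by (rule tendsto_eventually)
    ultimately show ?thesis by (rule LIMSEQ_unique)
  qed
  then show ?thesis using Fs(2) assms(4) by blast
qed

text \<open>Unit vectors form a compact set of representatives; compactness downstairs is obtained
  by mapping such sets down.\<close>

lemma compact_unit_cone:
  fixes T :: "'n::finite proj set"
  assumes "closed T"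
  shows "compact {v. norm v = 1 \<and> pt v \<in> T}"
proof -
  have "closed {v. norm v = 1 \<and> pt v \<in> T}"
  proof -
    have "{v. norm v = 1 \<and> pt v \<in> T} = sphere 0 1 \<inter> - pcone (- T)" by (auto simp: pcone_def)
    moreover have "open (pcone (- T))" using assms open_pcone_iff by auto
    ultimately show ?thesis by (metis closed_Compl closed_Int closed_sphere)
  qed
  moreover have "bounded {v::complex^'n. norm v = 1 \<and> pt v \<in> T}"
    by (rule boundedI[of _ 1]) auto
  ultimately show ?thesis by (simp add: compact_eq_bounded_closed)
qed

text \<open>This is properness of the projection to the base: the pairs of unit vectors representing
  points of \<open>S\<close> over \<open>T\<close> are closed in a compact product, and
  \<open>bipt\<close> maps them onto the preimage of \<open>T\<close>.\<close>

lemma compact_fibres: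
  fixes S :: "('n::finite proj \<times> 'm::finite proj) set"
  assumes "bizclosed S" "closed T"
  shows "compact {q \<in> S. snd q \<in> T}"
proof -
  let ?T = "{x \<in> sphere 0 1 \<times> {v. norm v = 1 \<and> pt v \<in> T}. x \<in> bicone S}"
  have K: "compact (sphere 0 1 \<times> {v. norm v = 1 \<and> pt v \<in> T} :: ('n,'m) bivec set)"
    by (intro compact_Times compact_unit_cone assms) auto
  have "closed ?T"
  proof (subst closed_sequential_limits, intro allI impI, elim conjE)
    fix y x assume y: "\<forall>k. y k \<in> ?T" and lim: "y \<longlonglongrightarrow> x"
    have *: "x \<in> sphere 0 1 \<times> {v. norm v = 1 \<and> pt v \<in> T}"
      using compact_imp_closed[OF K] y lim by (metis (no_types, lifting) closed_sequentially mem_Collect_eq)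
    then have "x \<in> bicone UNIV" by (auto simp: mem_bicone)
    then have "x \<in> bicone S" using bizclosed_limit[OF assms(1) _ lim] y by (simp add: always_eventually)
    then show "x \<in> ?T" using * by auto
  qed
  then have "compact ?T" using K by (metis (no_types, lifting) Int_absorb1 compact_Int_closed mem_Collect_eq subsetI)
  then have "compact (bipt ` ?T)"
    by (intro compact_continuous_image continuous_on_subset[OF continuous_on_bipt]) (auto simp: mem_bicone)
  moreover have "bipt ` ?T = {q \<in> S. snd q \<in> T}"
  proof (intro equalityI subsetI)
    fix q assume q: "q \<in> {q \<in> S. snd q \<in> T}"
    obtain u v where "norm u = 1" "fst q = pt u" "norm v = 1" "snd q = pt v"
      using pt_surj_unit by metis
    moreover from this have "(pt u, pt v) \<in> S" using q by (metis (no_types, lifting) mem_Collect_eq prod.collapse)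
    ultimately show "q \<in> bipt ` ?T" using q
      by (intro image_eqI[of _ _ "(u, v)"]) (auto simp: bipt_def mem_bicone prod_eq_iff)
  qed (auto simp: mem_bicone bipt_def)
  ultimately show ?thesis by simp
qed

section \<open>Bounds for forms on compact sets\<close>

text \<open>The Plucker coordinates of \<open>u\<close> and \<open>w\<close>, each occurring twice
  up to sign. They ignore multiples of \<open>u\<close> added to \<open>w\<close>, hence see only
  the tangent vector at \<open>pt u\<close> that \<open>w\<close> represents.\<close>

definition wedge :: "complex^'n \<Rightarrow> complex^'n \<Rightarrow> complex^'n^'n" where
  "wedge u w = (\<chi> i j. u $ i * w $ j - u $ j * w $ i)"

text \<open>The Fubini--Study length of the tangent vector at \<open>pt u\<close> represented by
  \<open>w\<close>, up to the factor \<open>sqrt 2\<close> that comes from the doubled coordinates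
  in \<open>wedge\<close>.\<close>

definition fs_norm :: "complex^'n \<Rightarrow> complex^'n \<Rightarrow> real" where
  "fs_norm u w = norm (wedge u w) / (norm u)\<^sup>2"

lemma fs_norm_nonneg: "0 \<le> fs_norm u w"
  by (simp add: fs_norm_def)

lemma wedge_component_le: "norm (u $ i * w $ j - u $ j * w $ i) \<le> norm (wedge u w)"
proof -
  have "norm (wedge u w $ i $ j) \<le> norm (wedge u w $ i)" by (rule Finite_Cartesian_Product.norm_nth_le)
  also have "\<dots> \<le> norm (wedge u w)" by (rule Finite_Cartesian_Product.norm_nth_le)
  finally show ?thesis by (simp add: wedge_def)
qed

lemma norm_smult: "norm (c *s v) = norm c * norm v" for v :: "complex^'n"
  by (simp add: norm_vec_def norm_mult L2_set_right_distrib)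

text \<open>The arguments are those forced by the product rule: if a lift is multiplied by a
  function with value \<open>c\<close> and derivative \<open>d\<close>, its derivative
  \<open>w\<close> becomes \<open>d *s u + c *s w\<close>. The factor \<open>c\<^sup>2\<close>
  cancels against the squared norm in \<open>fs_norm\<close>.\<close>

lemma wedge_change_lift: "wedge (c *s u) (d *s u + c *s w) = (\<chi> i. c\<^sup>2 *s (wedge u w $ i))"
  by (simp add: wedge_def vec_eq_iff algebra_simps power2_eq_square)

lemma fs_norm_change_lift:
  assumes "c \<noteq> 0"
  shows "fs_norm (c *s u) (d *s u + c *s w) = fs_norm u w"
proof -
  have "norm ((\<chi> i. c\<^sup>2 *s (wedge u w $ i)) :: complex^'a^'a) = (norm c)\<^sup>2 * norm (wedge u w)"
    by (simp add: norm_vec_def[where 'a="complex^'a"] norm_smult L2_set_right_distrib norm_power)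
  then show ?thesis using assms
    by (simp add: fs_norm_def wedge_change_lift norm_smult power_mult_distrib)
qed

lemma fs_norm_smult: "c \<noteq> 0 \<Longrightarrow> fs_norm (c *s u) (c *s w) = fs_norm u w"
  using fs_norm_change_lift[of c u 0 w] by simp

lemma norm_vec_le_sum: "norm (v :: 'a::real_normed_vector^'n) \<le> (\<Sum>i\<in>UNIV. norm (v $ i))"
  unfolding norm_vec_def by (intro L2_set_le_sum) auto

lemma large_component: "\<exists>j. norm u \<le> real CARD('n) * norm (u $ j)" for u :: "complex^'n"
proof (rule ccontr)
  assume "\<not> ?thesis"
  then have *: "norm (u $ j) < norm u / real CARD('n)" for j
    by (simp add: not_le pos_less_divide_eq mult.commute)
  have "(\<Sum>i\<in>UNIV. norm (u $ i)) < (\<Sum>i\<in>(UNIV::'n set). norm u / real CARD('n))"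
    by (rule sum_strict_mono) (use * in auto)
  then show False using norm_vec_le_sum[of u] by simp
qed

text \<open>Subtracting a multiple of \<open>u\<close> that kills a largest coordinate makes every tangent vector
  comparable to its Fubini--Study length.\<close>

lemma tangent_representative:
  fixes u w :: "complex^'n"
  assumes "u \<noteq> 0"
  shows "\<exists>s. norm (w - s *s u) \<le> (real CARD('n))\<^sup>2 * fs_norm u w * norm u"
proof -
  let ?n = "real CARD('n)"
  obtain j where j: "norm u \<le> ?n * norm (u $ j)" using large_component by blast
  then have uj: "u $ j \<noteq> 0" using assms by auto
  let ?s = "w $ j / u $ j"
  have "norm ((w - ?s *s u) $ i) \<le> ?n * fs_norm u w * norm u" for i
  proof -
    have "norm ((w - ?s *s u) $ i) = norm (u $ j * w $ i - u $ i * w $ j) / norm (u $ j)"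
      using uj by (simp add: field_simps flip: norm_divide)
    also have "\<dots> \<le> norm (wedge u w) / norm (u $ j)"
      by (intro divide_right_mono wedge_component_le) auto
    also have "\<dots> \<le> norm (wedge u w) / (norm u / ?n)"
      using j assms by (intro divide_left_mono) (auto simp: field_simps uj)
    also have "\<dots> = ?n * fs_norm u w * norm u"
      using assms by (simp add: fs_norm_def power2_eq_square)
    finally show ?thesis .
  qed
  then have "(\<Sum>i\<in>UNIV. norm ((w - ?s *s u) $ i)) \<le> (\<Sum>i\<in>(UNIV::'n set). ?n * fs_norm u w * norm u)"
    by (intro sum_mono)
  then have "norm (w - ?s *s u) \<le> ?n\<^sup>2 * fs_norm u w * norm u"
    using norm_vec_le_sum[of "w - ?s *s u"] by (simp add: power2_eq_square algebra_simps)
  then show ?thesis by blast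
qed

text \<open>The sum over basis pairs replaces the operator norm because
  \<open>smooth_11_form\<close> provides continuity in the base point for fixed vectors only; this
  sum is then visibly continuous.\<close>

lemma bilinear_bound_basis:
  fixes h :: "'a::euclidean_space \<Rightarrow> 'a \<Rightarrow> complex"
  assumes "bilinear h"
  shows "norm (h w w') \<le> (\<Sum>b\<in>Basis. \<Sum>c\<in>Basis. norm (h b c)) * norm w * norm w'"
proof -
  have "h w w' = (\<Sum>(b, c)\<in>Basis \<times> Basis. h ((w \<bullet> b) *\<^sub>R b) ((w' \<bullet> c) *\<^sub>R c))"
    using bilinear_sum[OF assms, of "\<lambda>b. (w \<bullet> b) *\<^sub>R b" Basis "\<lambda>b. (w' \<bullet> b) *\<^sub>R b" Basis]
    by (simp add: euclidean_representation)
  also have "\<dots> = (\<Sum>b\<in>Basis. \<Sum>c\<in>Basis. (w \<bullet> b) *\<^sub>R (w' \<bullet> c) *\<^sub>R h b c)"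
    by (simp add: sum.cartesian_product bilinear_lmul[OF assms] bilinear_rmul[OF assms] mult.commute)
  finally have "norm (h w w') \<le> (\<Sum>b\<in>Basis. \<Sum>c\<in>Basis. norm ((w \<bullet> b) *\<^sub>R (w' \<bullet> c) *\<^sub>R h b c))"
    by (auto intro!: order.trans[OF norm_sum] sum_mono)
  also have "\<dots> = (\<Sum>b\<in>Basis. \<Sum>c\<in>Basis. \<bar>w \<bullet> b\<bar> * (\<bar>w' \<bullet> c\<bar> * norm (h b c)))"
    by (simp add: abs_mult mult.assoc)
  also have "\<dots> \<le> (\<Sum>b\<in>Basis. \<Sum>c\<in>Basis. norm w * (norm w' * norm (h b c)))"
    by (intro sum_mono mult_mono Basis_le_norm mult_nonneg_nonneg) auto
  also have "\<dots> = (\<Sum>b\<in>Basis. \<Sum>c\<in>Basis. norm (h b c)) * norm w * norm w'"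
    by (simp add: sum_distrib_left sum_distrib_right algebra_simps)
  finally show ?thesis .
qed

lemma smooth_11_form_props:
  assumes "smooth_11_form U \<Omega>" "x \<in> bicone U"
  shows "bilinear (\<Omega> x)" "\<Omega> x w w = 0"
    "\<Omega> x (biscale s t x) w = 0"
    "s \<noteq> 0 \<Longrightarrow> t \<noteq> 0 \<Longrightarrow> \<Omega> (biscale s t x) (biscale s t w) (biscale s t w') = \<Omega> x w w'"
  using assms unfolding smooth_11_form_def by blast+

lemma smooth_11_form_Ck:
  assumes "smooth_11_form U \<Omega>"
  shows "Ck_on k (\<lambda>x. \<Omega> x w w') (bicone U)"
  by (rule assms[unfolded smooth_11_form_def, THEN conjunct2, THEN conjunct2, THEN spec, THEN spec, THEN spec])

text \<open>The form does not see the directions of the fibres of \<open>bipt\<close>, so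
  \<open>w\<close> may be replaced by the short representative \<open>y\<close> from
  \<open>tangent_representative\<close> in each factor. The bilinear bound gives \<open>M\<close>
  times the square of \<open>norm y\<close>, and the leading 2 comes from estimating the square of
  the sum of the two lengths.\<close>

lemma smooth_11_form_bound_at:
  fixes x :: "('n::finite, 'm::finite) bivec"
  assumes "smooth_11_form U \<Omega>" "x \<in> bicone U"
    and M: "(\<Sum>b\<in>Basis. \<Sum>c\<in>Basis. norm (\<Omega> x b c)) \<le> M" and R: "norm x \<le> R"
  shows "norm (\<Omega> x w (biscale \<i> \<i> w)) \<le>
    2 * M * ((real CARD('n))\<^sup>2 + (real CARD('m))\<^sup>2)\<^sup>2 * R\<^sup>2 * ((fs_norm (fst x) (fst w))\<^sup>2 + (fs_norm (snd x) (snd w))\<^sup>2)"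
proof -
  let ?a = "fs_norm (fst x) (fst w)" and ?b = "fs_norm (snd x) (snd w)"
  let ?n = "(real CARD('n))\<^sup>2" and ?m = "(real CARD('m))\<^sup>2"
  note props = smooth_11_form_props[OF assms(1,2)]
  have nz: "fst x \<noteq> 0" "snd x \<noteq> 0" using assms(2) by (auto simp: mem_bicone)
  obtain s where s: "norm (fst w - s *s fst x) \<le> ?n * ?a * norm (fst x)"
    using tangent_representative[OF nz(1)] by blast
  obtain t where t: "norm (snd w - t *s snd x) \<le> ?m * ?b * norm (snd x)"
    using tangent_representative[OF nz(2)] by blast
  define y where "y = w - biscale s t x"
  \<comment> \<open>Vanishing along the fibres is postulated in the first argument only;
    antisymmetry, from polarising \<open>\<Omega> x w w = 0\<close>, moves it to the second.\<close>
  have anti: "\<Omega> x p q = - \<Omega> x q p" for p q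
  proof -
    have "0 = \<Omega> x (p + q) (p + q)" using props(2) by simp
    also have "\<dots> = \<Omega> x p q + \<Omega> x q p"
      by (simp add: bilinear_ladd[OF props(1)] bilinear_radd[OF props(1)] props(2)[of p] props(2)[of q])
    finally show ?thesis by (metis eq_neg_iff_add_eq_0)
  qed
  have right: "\<Omega> x q (biscale s' t' x) = 0" for q s' t'
    using anti[of q] props(3) by simp
  \<comment> \<open>Fibre directions are complex subspaces, so multiplication by \<open>\<i>\<close>
    changes the correction term into another vector along the fibre.\<close>
  have iy: "biscale \<i> \<i> y = biscale \<i> \<i> w - biscale (\<i> * s) (\<i> * t) x"
    by (simp add: y_def biscale_def prod_eq_iff vec_eq_iff algebra_simps)
  have "\<Omega> x w (biscale \<i> \<i> w) = \<Omega> x y (biscale \<i> \<i> y)"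
    unfolding iy unfolding y_def
    by (simp add: bilinear_lsub[OF props(1)] bilinear_rsub[OF props(1)] props(3) right)
  moreover have "norm (biscale \<i> \<i> y) = norm y"
    by (simp add: norm_prod_def norm_smult biscale_def)
  ultimately have \<Omega>y: "norm (\<Omega> x w (biscale \<i> \<i> w)) \<le> M * (norm y)\<^sup>2"
    using bilinear_bound_basis[OF props(1), of y "biscale \<i> \<i> y"] mult_right_mono[OF M, of "(norm y)\<^sup>2"]
    by (simp add: power2_eq_square mult.assoc)
  have "norm y \<le> (?n + ?m) * R * (?a + ?b)"
  proof -
    have "norm y \<le> norm (fst y) + norm (snd y)" by (metis norm_Pair_le prod.collapse)
    also have "\<dots> \<le> ?n * ?a * norm (fst x) + ?m * ?b * norm (snd x)"
      using s t by (simp add: y_def)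
    also have "\<dots> \<le> ?n * ?a * R + ?m * ?b * R"
    proof -
      have "norm (fst x) \<le> R" "norm (snd x) \<le> R"
        using R norm_fst_le[of "fst x" "snd x"] norm_snd_le[of "snd x" "fst x"] by simp_all
      then show ?thesis by (intro add_mono mult_left_mono) (simp_all add: fs_norm_nonneg)
    qed
    also have "\<dots> \<le> (?n + ?m) * R * (?a + ?b)"
    proof -
      have "0 \<le> ?n * R * ?b" "0 \<le> ?m * R * ?a"
        using order.trans[OF norm_ge_zero R] by (simp_all add: fs_norm_nonneg)
      then show ?thesis by (simp add: algebra_simps)
    qed
    finally show ?thesis .
  qed
  then have "(norm y)\<^sup>2 \<le> ((?n + ?m) * R * (?a + ?b))\<^sup>2" by (intro power_mono) auto
  also have "\<dots> = (?n + ?m)\<^sup>2 * R\<^sup>2 * (?a + ?b)\<^sup>2" by (simp add: power_mult_distrib)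
  also have "\<dots> \<le> (?n + ?m)\<^sup>2 * R\<^sup>2 * (2 * (?a\<^sup>2 + ?b\<^sup>2))"
    using sum_squares_bound[of ?a ?b] by (intro mult_left_mono) (auto simp: power2_sum)
  finally have "(norm y)\<^sup>2 \<le> (?n + ?m)\<^sup>2 * R\<^sup>2 * (2 * (?a\<^sup>2 + ?b\<^sup>2))" .
  moreover have "0 \<le> M" using M by (meson norm_ge_zero order.trans sum_nonneg)
  ultimately have "M * (norm y)\<^sup>2 \<le> M * ((?n + ?m)\<^sup>2 * R\<^sup>2 * (2 * (?a\<^sup>2 + ?b\<^sup>2)))"
    by (rule mult_left_mono)
  also have "\<dots> = 2 * M * (?n + ?m)\<^sup>2 * R\<^sup>2 * (?a\<^sup>2 + ?b\<^sup>2)" by (simp add: algebra_simps)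
  finally show ?thesis using \<Omega>y by linarith
qed

lemma compact_neighbourhood_in_cone:
  fixes U :: "('n::finite proj \<times> 'm::finite proj) set"
  assumes "open U" "p \<in> U"
  obtains x r where "0 < r" "p = bipt x" "cball x r \<subseteq> bicone U"
proof -
  obtain u v where "u \<noteq> 0" "fst p = pt u" "v \<noteq> 0" "snd p = pt v" using pt_surj by metis
  moreover from this have "p = bipt (u, v)" by (simp add: bipt_def prod_eq_iff)
  ultimately have *: "p = bipt (u, v)" "(u, v) \<in> bicone U" using assms(2) by (auto simp: mem_bicone bipt_def)
  then obtain r where "0 < r" "cball (u, v) r \<subseteq> bicone U"
    using open_bicone[OF assms(1)] open_contains_cball by blast
  then show ?thesis using that * by blast
qed

lemma bicone_mono: "S \<subseteq> T \<Longrightarrow> bicone S \<subseteq> bicone T"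
  by (auto simp: mem_bicone)

lemma open_bipt_ball:
  fixes x :: "('n::finite, 'm::finite) bivec"
  assumes "cball x r \<subseteq> bicone U"
  shows "open (bipt ` ball x r)"
proof (rule open_bipt_image)
  show "ball x r \<subseteq> bicone UNIV"
    using assms bicone_mono[of U UNIV] ball_subset_cball[of x r] by blast
qed auto

text \<open>The cone over a compact set is not compact, as its vectors are unbounded and come close
  to zero. The entries of the form are therefore bounded on a closed ball upstairs, and invariance
  of both sides under \<open>biscale\<close> spreads the estimate to the full cone over the image of
  the open ball. For finitely many such images the sum of the absolute constants works.\<close>

lemma smooth_11_form_bound:
  fixes \<Omega> :: "('n::finite, 'm::finite) two_form"
  assumes \<Omega>: "smooth_11_form U \<Omega>" and Q: "compact Q" "Q \<subseteq> U"
  shows "\<exists>C. \<forall>y\<in>bicone Q. \<forall>w. norm (\<Omega> y w (biscale \<i> \<i> w)) \<le>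
    C * ((fs_norm (fst y) (fst w))\<^sup>2 + (fs_norm (snd y) (snd w))\<^sup>2)"
proof -
  define bnd where "bnd S C \<longleftrightarrow> (\<forall>y\<in>bicone S. \<forall>w. norm (\<Omega> y w (biscale \<i> \<i> w)) \<le>
    C * ((fs_norm (fst y) (fst w))\<^sup>2 + (fs_norm (snd y) (snd w))\<^sup>2))" for S C
  have U: "open U" using \<Omega> by (simp add: smooth_11_form_def)
  have "\<exists>V C. open V \<and> p \<in> V \<and> bnd V C" if pQ: "p \<in> Q" for p
  proof -
    obtain x r where x: "0 < r" "p = bipt x" "cball x r \<subseteq> bicone U"
      by (rule compact_neighbourhood_in_cone[OF U subsetD[OF Q(2) pQ]])
    let ?N = "\<lambda>x. \<Sum>b\<in>Basis. \<Sum>c\<in>Basis. norm (\<Omega> x b c)"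
    have "continuous_on (cball x r) (\<lambda>x. \<Omega> x b c)" for b c
      using smooth_11_form_Ck[OF \<Omega>, of 0 b c] x(3) by (auto intro: continuous_on_subset)
    then have "continuous_on (cball x r) ?N" by (intro continuous_intros)
    then have "bounded (?N ` cball x r)" by (intro compact_imp_bounded compact_continuous_image) auto
    then obtain M where "\<forall>v\<in>?N ` cball x r. norm v \<le> M" unfolding bounded_iff by blast
    then have M: "?N y \<le> M" if "y \<in> cball x r" for y
      using that abs_le_D1[of "?N y" M] unfolding real_norm_def by blast
    let ?R = "norm x + r"
    let ?C = "2 * M * ((real CARD('n))\<^sup>2 + (real CARD('m))\<^sup>2)\<^sup>2 * ?R\<^sup>2"
    have "bnd (bipt ` ball x r) ?C"
      unfolding bnd_def
    proof (intro ballI allI)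
      fix y w :: "('n, 'm) bivec" assume y: "y \<in> bicone (bipt ` ball x r)"
      then obtain x' where x': "x' \<in> ball x r" "bipt y = bipt x'" by (auto simp: bicone_def)
      then have x'U: "x' \<in> bicone U" using x(3) by auto
      have "y \<in> bicone UNIV" "x' \<in> bicone UNIV" using y x'U by (auto simp: mem_bicone)
      then obtain s t where st: "s \<noteq> 0" "t \<noteq> 0" "x' = biscale s t y"
        using x'(2) bipt_eq_imp_biscale by metis
      have yU: "y \<in> bicone U" using \<open>y \<in> bicone UNIV\<close> x'U x'(2) by (auto simp: bicone_def)
      let ?w = "biscale s t w"
      have "norm (x' - x) < r" using x'(1) by (simp add: dist_norm norm_minus_commute)
      then have "norm x' \<le> ?R" using norm_triangle_sub[of x' x] by simp
      have "norm (\<Omega> x' ?w (biscale \<i> \<i> ?w)) \<le>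
          ?C * ((fs_norm (fst x') (fst ?w))\<^sup>2 + (fs_norm (snd x') (snd ?w))\<^sup>2)"
        by (rule smooth_11_form_bound_at[OF \<Omega> x'U M]) (use x'(1) \<open>norm x' \<le> ?R\<close> in auto)
      moreover have "biscale \<i> \<i> ?w = biscale s t (biscale \<i> \<i> w)"
        by (simp add: biscale_def vector_smult_assoc mult.commute)
      then have "\<Omega> x' ?w (biscale \<i> \<i> ?w) = \<Omega> y w (biscale \<i> \<i> w)"
        using smooth_11_form_props(4)[OF \<Omega> yU st(1,2)] st(3) by simp
      ultimately show "norm (\<Omega> y w (biscale \<i> \<i> w)) \<le>
          ?C * ((fs_norm (fst y) (fst w))\<^sup>2 + (fs_norm (snd y) (snd w))\<^sup>2)"
        using st by (simp add: fs_norm_smult)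
    qed
    moreover have "open (bipt ` ball x r)" using open_bipt_ball x(3) .
    moreover have "p \<in> bipt ` ball x r" using x by auto
    ultimately show ?thesis by blast
  qed
  then obtain V C where VC: "\<And>p. p \<in> Q \<Longrightarrow> open (V p) \<and> p \<in> V p \<and> bnd (V p) (C p)" by metis
  obtain F where F: "F \<subseteq> Q" "finite F" "Q \<subseteq> (\<Union>p\<in>F. V p)"
    by (rule compactE_image[OF Q(1), of Q V]) (use VC in blast)+
  let ?C = "\<Sum>p\<in>F. \<bar>C p\<bar>"
  have "bnd Q ?C"
    unfolding bnd_def
  proof (intro ballI allI)
    fix y w :: "('n, 'm) bivec" assume "y \<in> bicone Q"
    then obtain p where p: "p \<in> F" "y \<in> bicone (V p)" using F(3) by (auto simp: mem_bicone)
    let ?e = "(fs_norm (fst y) (fst w))\<^sup>2 + (fs_norm (snd y) (snd w))\<^sup>2"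
    have "norm (\<Omega> y w (biscale \<i> \<i> w)) \<le> C p * ?e"
      using VC[of p] p F(1) unfolding bnd_def by blast
    also have "\<dots> \<le> ?C * ?e"
    proof (rule mult_right_mono)
      have "\<bar>C p\<bar> \<le> ?C" using p(1) F(2) by (intro member_le_sum) auto
      then show "C p \<le> ?C" by linarith
    qed auto
    finally show "norm (\<Omega> y w (biscale \<i> \<i> w)) \<le> ?C * ?e" .
  qed
  then show ?thesis unfolding bnd_def by blast
qed

section \<open>Finite covers by local extensions of the form\<close>

lemma Ck_on_subset: "Ck_on k f S \<Longrightarrow> T \<subseteq> S \<Longrightarrow> Ck_on k f T"
proof (induction k arbitrary: f)
  case 0
  then show ?case using continuous_on_subset by auto
next
  case (Suc k)
  then show ?case by (metis Ck_on.simps(2) subsetD)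
qed

lemma smooth_11_form_subset:
  assumes "smooth_11_form U \<Omega>" "open V" "V \<subseteq> U"
  shows "smooth_11_form V \<Omega>"
proof -
  note sub = bicone_mono[OF assms(3)]
  have "Ck_on k (\<lambda>x. \<Omega> x w w') (bicone V)" for w w' k
    using Ck_on_subset[OF smooth_11_form_Ck[OF assms(1)] sub] .
  then show ?thesis
    using assms(1,2) sub unfolding smooth_11_form_def by (intro conjI ballI) (elim conjE, (blast | assumption))+
qed

text \<open>The list inside \<open>extension_at\<close> is picked by \<open>SOME\<close>, so it has
  its defining property only once some cover is known to exist. The compact pieces are images of
  closed balls in the cone; the images of the open balls are open and give the finite
  subcover.\<close>

lemma extension_cover_exists:
  fixes S W :: "('n::finite proj \<times> 'm::finite proj) set"
  assumes W: "openin (top_of_set S) W" and "compact C" "C \<subseteq> W" and \<omega>: "real_11_form_on S W \<omega>"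
  shows "\<exists>L. extension_cover S C \<omega> L"
proof -
  obtain W' where W': "open W'" "W = S \<inter> W'" using W by (auto simp: openin_open)
  define ok where "ok Q \<Omega> \<longleftrightarrow> compact Q \<and> (\<exists>U. Q \<subseteq> U \<and> smooth_11_form U \<Omega> \<and> extends_form S U \<Omega> \<omega>)" for Q \<Omega>
  have "\<exists>V Q \<Omega>. open V \<and> p \<in> V \<and> V \<subseteq> Q \<and> ok Q \<Omega>" if "p \<in> C" for p
  proof -
    have "p \<in> W" using that assms by auto
    then obtain U \<Omega> where U: "p \<in> U" "smooth_11_form U \<Omega>" "extends_form S (U \<inter> W) \<Omega> \<omega>"
      using \<omega> by (auto simp: real_11_form_on_def)
    have "open (U \<inter> W')" using U(2) W'(1) by (auto simp: smooth_11_form_def)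
    moreover have "p \<in> U \<inter> W'" using U(1) \<open>p \<in> W\<close> W'(2) by auto
    ultimately obtain x r where x: "0 < r" "p = bipt x" "cball x r \<subseteq> bicone (U \<inter> W')"
      using compact_neighbourhood_in_cone by blast
    have "continuous_on (cball x r) bipt"
      using continuous_on_bipt x(3) bicone_mono[of "U \<inter> W'" UNIV] continuous_on_subset by blast
    then have "compact (bipt ` cball x r)" by (intro compact_continuous_image) auto
    moreover have "bipt ` cball x r \<subseteq> U \<inter> W'" using x(3) by (auto simp: bicone_def)
    moreover have "smooth_11_form (U \<inter> W') \<Omega>"
      using smooth_11_form_subset[OF U(2) \<open>open (U \<inter> W')\<close>] by auto
    \<comment> \<open>The given extension agrees with \<open>\<omega>\<close> over
      \<open>U \<inter> W\<close>, whereas the cover needs a set open in the ambient space. As the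
      smooth locus lies in \<open>S\<close>, replacing \<open>W\<close> by \<open>W'\<close> adds no
      smooth points.\<close>
    moreover have "smooth_locus S \<inter> (U \<inter> W') \<subseteq> smooth_locus S \<inter> (U \<inter> W)"
      using W'(2) by (auto simp: smooth_locus_def)
    then have "extends_form S (U \<inter> W') \<Omega> \<omega>"
      using U(3) bicone_mono unfolding extends_form_def by blast
    ultimately have "ok (bipt ` cball x r) \<Omega>" unfolding ok_def by blast
    moreover have "open (bipt ` ball x r)" using open_bipt_ball x(3) .
    moreover have "p \<in> bipt ` ball x r" using x by auto
    moreover have "bipt ` ball x r \<subseteq> bipt ` cball x r" by (intro image_mono ball_subset_cball)
    ultimately show ?thesis by blast
  qed
  then obtain V Q \<Omega> where VQ: "\<And>p. p \<in> C \<Longrightarrow> open (V p) \<and> p \<in> V p \<and> V p \<subseteq> Q p \<and> ok (Q p) (\<Omega> p)" by metis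
  obtain F where F: "F \<subseteq> C" "finite F" "C \<subseteq> (\<Union>p\<in>F. V p)"
    by (rule compactE_image[OF assms(2), of C V]) (use VQ in blast)+
  obtain ps where ps: "set ps = F" using F(2) finite_list by blast
  have "extension_cover S C \<omega> (map (\<lambda>p. (Q p, \<Omega> p)) ps)"
    unfolding extension_cover_def
  proof (intro conjI subsetI)
    show "\<forall>(P, \<Theta>)\<in>set (map (\<lambda>p. (Q p, \<Omega> p)) ps). compact P \<and>
        (\<exists>U. P \<subseteq> U \<and> smooth_11_form U \<Theta> \<and> extends_form S U \<Theta> \<omega>)"
      using F(1) VQ ps by (auto simp: ok_def)
    fix q assume "q \<in> C"
    then obtain p where "p \<in> F" "q \<in> V p" using F(3) by blast
    then have "q \<in> Q p" using F(1) VQ by blast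
    then show "q \<in> (\<Union>(P, \<Theta>)\<in>set (map (\<lambda>p. (Q p, \<Omega> p)) ps). P)"
      using \<open>p \<in> F\<close> ps by auto
  qed
  then show ?thesis by blast
qed

section \<open>Speed of holomorphic curves in projective space\<close>

text \<open>The lift represents \<open>f\<close> on a full neighbourhood of \<open>z\<close>,
  whereas \<open>proj_holomorphic_on\<close> compares values only inside the given set. This makes
  derivatives at \<open>z\<close> meaningful without reference to a domain; on open sets both
  notions agree.\<close>

definition proj_lift :: "(complex \<Rightarrow> 'n::finite proj) \<Rightarrow> complex \<Rightarrow> (complex \<Rightarrow> complex^'n) \<Rightarrow> bool" where
  "proj_lift f z G \<longleftrightarrow> (\<exists>N. open N \<and> z \<in> N \<and> vec_holomorphic_on G N \<and> (\<forall>t\<in>N. G t \<noteq> 0 \<and> f t = pt (G t)))"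

definition vderiv :: "(complex \<Rightarrow> complex^'n) \<Rightarrow> complex \<Rightarrow> complex^'n" where
  "vderiv G z = (\<chi> i. deriv (\<lambda>t. G t $ i) z)"

lemma proj_lift_eq: "proj_lift f z G \<Longrightarrow> G z \<noteq> 0 \<and> f z = pt (G z)"
  by (auto simp: proj_lift_def)

lemma proj_holomorphic_on_open:
  assumes "open S"
  shows "proj_holomorphic_on f S \<longleftrightarrow> (\<forall>z\<in>S. \<exists>G. proj_lift f z G)"
proof
  assume hol: "proj_holomorphic_on f S"
  show "\<forall>z\<in>S. \<exists>G. proj_lift f z G"
  proof
    fix z assume z: "z \<in> S"
    obtain N G where NG: "open N" "z \<in> N" "vec_holomorphic_on G N" "\<forall>t\<in>N. G t \<noteq> 0" "\<forall>t\<in>N \<inter> S. f t = pt (G t)"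
      using hol z unfolding proj_holomorphic_on_def by metis
    moreover from NG(3) have "vec_holomorphic_on G (N \<inter> S)"
      unfolding vec_holomorphic_on_def using holomorphic_on_subset by blast
    ultimately have "proj_lift f z G"
      unfolding proj_lift_def using z assms by (intro exI[of _ "N \<inter> S"]) auto
    then show "\<exists>G. proj_lift f z G" by blast
  qed
next
  assume lift: "\<forall>z\<in>S. \<exists>G. proj_lift f z G"
  show "proj_holomorphic_on f S"
    unfolding proj_holomorphic_on_def
  proof
    fix z assume "z \<in> S"
    then obtain G N where "open N" "z \<in> N" "vec_holomorphic_on G N" "\<forall>t\<in>N. G t \<noteq> 0 \<and> f t = pt (G t)"
      using lift unfolding proj_lift_def by blast
    then show "\<exists>N G. open N \<and> z \<in> N \<and> vec_holomorphic_on G N \<and> (\<forall>t\<in>N. G t \<noteq> 0) \<and> (\<forall>t\<in>N \<inter> S. f t = pt (G t))"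
      by (intro exI[of _ N] exI[of _ G]) simp
  qed
qed

text \<open>Two lifts differ by a nowhere zero holomorphic factor near \<open>z\<close>, and the
  product rule reduces the claim to \<open>fs_norm_change_lift\<close>.\<close>

lemma fs_norm_lift_unique:
  assumes "proj_lift f z G" "proj_lift f z H"
  shows "fs_norm (H z) (vderiv H z) = fs_norm (G z) (vderiv G z)"
proof -
  obtain N where N: "open N" "z \<in> N" "vec_holomorphic_on G N" "\<And>t. t \<in> N \<Longrightarrow> G t \<noteq> 0 \<and> f t = pt (G t)"
    using assms(1) unfolding proj_lift_def by blast
  obtain N' where N': "open N'" "z \<in> N'" "vec_holomorphic_on H N'" "\<And>t. t \<in> N' \<Longrightarrow> H t \<noteq> 0 \<and> f t = pt (H t)"
    using assms(2) unfolding proj_lift_def by blast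
  have "G z \<noteq> 0" using N by blast
  then obtain j where j: "G z $ j \<noteq> 0" by (auto simp: vec_eq_iff)
  \<comment> \<open>Equality in projective space yields a factor separately for each
    \<open>t\<close>; a quotient of coordinates exhibits it as a holomorphic function.\<close>
  define c where "c t = H t $ j / G t $ j" for t
  have Gh: "(\<lambda>t. G t $ i) holomorphic_on N" and Hh: "(\<lambda>t. H t $ i) holomorphic_on N'" for i
    using N(3) N'(3) by (auto simp: vec_holomorphic_on_def)
  define M where "M = N \<inter> N' \<inter> {t \<in> N. G t $ j \<noteq> 0}"
  have "open {t \<in> N. G t $ j \<noteq> 0}"
  proof -
    have "{t \<in> N. G t $ j \<noteq> 0} = N \<inter> (\<lambda>t. G t $ j) -` (- {0})" by auto
    then show ?thesis
      using continuous_open_preimage[OF holomorphic_on_imp_continuous_on[OF Gh] N(1), of "-{0}"]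
      by (simp add: open_Compl)
  qed
  then have M: "open M" "z \<in> M" using N N' j by (auto simp: M_def)
  have eq: "H t = c t *s G t" if "t \<in> M" for t
  proof -
    have "pt (G t) = pt (H t)" "G t \<noteq> 0" "H t \<noteq> 0" using that N(4)[of t] N'(4)[of t] by (simp_all add: M_def)
    then obtain d where d: "H t = d *s G t" using pt_eq_iff by metis
    then have "c t = d" using that by (simp add: c_def M_def)
    then show ?thesis using d by simp
  qed
  have cz: "c z \<noteq> 0"
    using eq[OF M(2)] N'(4)[OF N'(2)] by auto
  have ch: "c holomorphic_on M" unfolding c_def
    by (intro holomorphic_on_divide holomorphic_on_subset[OF Gh] holomorphic_on_subset[OF Hh]) (auto simp: M_def)
  have "vderiv H z = deriv c z *s G z + c z *s vderiv G z"
  proof -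
    have "deriv (\<lambda>t. H t $ i) z = deriv c z * G z $ i + c z * deriv (\<lambda>t. G t $ i) z" for i
    proof -
      have "(c has_field_derivative deriv c z) (at z)"
        using ch M holomorphic_derivI by blast
      moreover have "((\<lambda>t. G t $ i) has_field_derivative deriv (\<lambda>t. G t $ i) z) (at z)"
        using Gh N(1,2) holomorphic_derivI by blast
      ultimately have "((\<lambda>t. c t * G t $ i) has_field_derivative deriv c z * G z $ i + c z * deriv (\<lambda>t. G t $ i) z) (at z)"
        by (auto intro!: derivative_eq_intros)
      moreover have "c t * G t $ i = H t $ i" if "t \<in> M" for t using eq[OF that] by simp
      ultimately have "((\<lambda>t. H t $ i) has_field_derivative deriv c z * G z $ i + c z * deriv (\<lambda>t. G t $ i) z) (at z)"
        by (rule has_field_derivative_transform_within_open[OF _ M])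
      then show ?thesis by (rule DERIV_imp_deriv)
    qed
    then show ?thesis by (simp add: vderiv_def vec_eq_iff)
  qed
  then show ?thesis using eq[OF M(2)] fs_norm_change_lift[OF cz] by simp
qed

definition proj_speed :: "(complex \<Rightarrow> 'n::finite proj) \<Rightarrow> complex \<Rightarrow> real" where
  "proj_speed f z = (let G = SOME G. proj_lift f z G in fs_norm (G z) (vderiv G z))"

lemma proj_speed_eq:
  assumes "proj_lift f z G"
  shows "proj_speed f z = fs_norm (G z) (vderiv G z)"
  using fs_norm_lift_unique[OF assms someI[of "proj_lift f z", OF assms]]
  by (simp add: proj_speed_def)

lemma proj_speed_nonneg: "0 \<le> proj_speed f z"
  by (simp add: proj_speed_def fs_norm_nonneg Let_def)

text \<open>A lift at \<open>z\<close> is also a lift at all nearby points, so a single formula in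
  the lift and its derivative computes the speed near \<open>z\<close>.\<close>

lemma continuous_on_proj_speed:
  assumes "open S" "proj_holomorphic_on f S"
  shows "continuous_on S (proj_speed f)"
proof (rule continuous_at_imp_continuous_on, intro ballI)
  fix z assume "z \<in> S"
  then obtain G where G: "proj_lift f z G" using assms proj_holomorphic_on_open by blast
  then obtain N where N: "open N" "z \<in> N" "vec_holomorphic_on G N" "\<And>t. t \<in> N \<Longrightarrow> G t \<noteq> 0 \<and> f t = pt (G t)"
    unfolding proj_lift_def by blast
  have Gh: "(\<lambda>t. G t $ i) holomorphic_on N" for i using N(3) by (auto simp: vec_holomorphic_on_def)
  have "proj_speed f t = fs_norm (G t) (vderiv G t)" if "t \<in> N" for t
    using that N by (intro proj_speed_eq) (auto simp: proj_lift_def)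
  moreover have "continuous_on N (\<lambda>t. fs_norm (G t) (vderiv G t))"
  proof -
    have c1: "continuous_on N (\<lambda>t. G t $ i)" for i using Gh holomorphic_on_imp_continuous_on by blast
    have c2: "continuous_on N (\<lambda>t. deriv (\<lambda>t. G t $ i) t)" for i
      using holomorphic_deriv[OF Gh N(1)] holomorphic_on_imp_continuous_on by blast
    have "continuous_on N (\<lambda>t. \<chi> i. G t $ i)" by (intro continuous_on_vec_lambda c1)
    then have "continuous_on N (\<lambda>t. norm (G t))" by (intro continuous_on_norm) simp
    moreover have "continuous_on N (\<lambda>t. wedge (G t) (vderiv G t))"
      unfolding wedge_def vderiv_def
      by (simp, intro continuous_on_vec_lambda continuous_on_diff continuous_on_mult c1 c2)
    ultimately show ?thesis unfolding fs_norm_def using N(4) by (auto intro!: continuous_intros)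
  qed
  ultimately have "continuous_on N (proj_speed f)" by (simp cong: continuous_on_cong)
  then show "isCont (proj_speed f) z" using N(1,2) continuous_on_eq_continuous_at by blast
qed

lemma proj_lift_affine:
  assumes "proj_lift f (a + c * z) G"
  shows "proj_lift (\<lambda>t. f (a + c * t)) z (\<lambda>t. G (a + c * t))"
proof -
  obtain N where N: "open N" "a + c * z \<in> N" "vec_holomorphic_on G N" "\<And>t. t \<in> N \<Longrightarrow> G t \<noteq> 0 \<and> f t = pt (G t)"
    using assms unfolding proj_lift_def by blast
  let ?M = "(\<lambda>t. a + c * t) -` N"
  have "open ?M" by (intro open_vimage N continuous_intros)
  moreover have "vec_holomorphic_on (\<lambda>t. G (a + c * t)) ?M"
    unfolding vec_holomorphic_on_def
  proof
    fix i
    have "(\<lambda>t. G t $ i) holomorphic_on N" using N(3) by (simp add: vec_holomorphic_on_def)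
    then have "(\<lambda>t. G t $ i) \<circ> (\<lambda>t. a + c * t) holomorphic_on ?M"
      by (intro holomorphic_on_compose_gen holomorphic_intros) auto
    then show "(\<lambda>t. G (a + c * t) $ i) holomorphic_on ?M" by (simp add: o_def)
  qed
  ultimately show ?thesis unfolding proj_lift_def using N by (intro exI[of _ ?M]) auto
qed

lemma fs_norm_smult_right: "fs_norm u (c *s w) = norm c * fs_norm u w"
proof -
  have "wedge u (c *s w) = (\<chi> i. c *s (wedge u w $ i))"
    by (simp add: wedge_def vec_eq_iff algebra_simps)
  moreover have "norm ((\<chi> i. c *s (wedge u w $ i)) :: complex^'a^'a) = norm c * norm (wedge u w)"
    by (simp add: norm_vec_def[where 'a="complex^'a"] norm_smult L2_set_right_distrib)
  ultimately show ?thesis by (simp add: fs_norm_def)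
qed

text \<open>This is the chain rule for lifts. Taking for \<open>c\<close> the inverse of the speed
  at \<open>a\<close> normalises the speed at the origin to 1.\<close>

lemma proj_speed_affine:
  assumes "proj_lift f (a + c * z) G"
  shows "proj_speed (\<lambda>t. f (a + c * t)) z = norm c * proj_speed f (a + c * z)"
proof -
  obtain N where N: "open N" "a + c * z \<in> N" "vec_holomorphic_on G N"
    using assms unfolding proj_lift_def by blast
  have "vderiv (\<lambda>t. G (a + c * t)) z = c *s vderiv G (a + c * z)"
  proof -
    have "deriv (\<lambda>t. G (a + c * t) $ i) z = c * deriv (\<lambda>t. G t $ i) (a + c * z)" for i
    proof -
      have "((\<lambda>t. G t $ i) has_field_derivative deriv (\<lambda>t. G t $ i) (a + c * z)) (at (a + c * z))"
        using N holomorphic_derivI unfolding vec_holomorphic_on_def by blast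
      moreover have "((\<lambda>t. a + c * t) has_field_derivative c) (at z)" by (auto intro!: derivative_eq_intros)
      ultimately have "((\<lambda>t. G (a + c * t) $ i) has_field_derivative deriv (\<lambda>t. G t $ i) (a + c * z) * c) (at z)"
        using DERIV_chain2 by fastforce
      then show ?thesis by (simp add: DERIV_imp_deriv mult.commute)
    qed
    then show ?thesis by (simp add: vderiv_def vec_eq_iff)
  qed
  then show ?thesis
    using proj_speed_eq[OF proj_lift_affine[OF assms]] proj_speed_eq[OF assms] by (simp add: fs_norm_smult_right)
qed

section \<open>Embedding projective space by orthogonal projections onto lines\<close>

definition projector :: "complex^'n \<Rightarrow> complex^'n^'n" where
  "projector u = (\<chi> i j. u $ i * cnj (u $ j) / (\<Sum>k\<in>UNIV. u $ k * cnj (u $ k)))"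

definition pmat :: "'n proj \<Rightarrow> complex^'n^'n" where
  "pmat p = projector (SOME v. v \<noteq> 0 \<and> p = pt v)"

text \<open>The denominator of \<open>projector\<close> is kept as a complex sum of products, so
  that the rules for derivatives of products and quotients apply to it; this identity translates it
  into the norm when estimates are needed.\<close>

lemma sum_mult_cnj: "(\<Sum>k\<in>UNIV. u $ k * cnj (u $ k)) = of_real ((norm (u :: complex^'n))\<^sup>2)"
proof -
  have "(norm u)\<^sup>2 = (\<Sum>k\<in>UNIV. (norm (u $ k))\<^sup>2)"
    unfolding norm_vec_def L2_set_def by (simp add: sum_nonneg)
  then show ?thesis by (simp add: complex_norm_square del: of_real_power)
qed

lemma projector_smult: "c \<noteq> 0 \<Longrightarrow> projector (c *s u) = projector u"
proof -
  assume "c \<noteq> 0"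
  have "(\<Sum>k\<in>UNIV. (c *s u) $ k * cnj ((c *s u) $ k)) = (c * cnj c) * (\<Sum>k\<in>UNIV. u $ k * cnj (u $ k))"
    by (simp add: sum_distrib_left algebra_simps)
  moreover have "(c *s u) $ i * cnj ((c *s u) $ j) = (c * cnj c) * (u $ i * cnj (u $ j))" for i j by simp
  moreover have "c * cnj c \<noteq> 0" using \<open>c \<noteq> 0\<close> by simp
  ultimately show ?thesis
    unfolding projector_def by (simp only: mult_divide_mult_cancel_left[OF \<open>c * cnj c \<noteq> 0\<close>])
qed

lemma pmat_pt:
  assumes "v \<noteq> 0"
  shows "pmat (pt v) = projector v"
proof -
  let ?w = "SOME w. w \<noteq> 0 \<and> pt v = pt w"
  have w: "?w \<noteq> 0 \<and> pt v = pt ?w" by (rule someI[of _ v]) (use assms in simp)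
  then obtain c where c: "?w = c *s v" using pt_eq_iff[OF assms, of ?w] by metis
  with w have "c \<noteq> 0" by auto
  then show ?thesis unfolding pmat_def using c projector_smult[of c v] by metis
qed

lemma norm_matrix_le:
  fixes A :: "complex^'n^'n"
  assumes "\<And>i j. norm (A $ i $ j) \<le> e"
  shows "norm A \<le> (real CARD('n))\<^sup>2 * e"
proof -
  have "norm A \<le> (\<Sum>i\<in>UNIV. norm (A $ i))" by (rule norm_vec_le_sum)
  also have "\<dots> \<le> (\<Sum>i\<in>UNIV. \<Sum>j\<in>UNIV. norm (A $ i $ j))" by (intro sum_mono norm_vec_le_sum)
  also have "\<dots> \<le> (\<Sum>i\<in>(UNIV::'n set). \<Sum>j\<in>(UNIV::'n set). e)" by (intro sum_mono assms)
  finally show ?thesis by (simp add: power2_eq_square mult.assoc)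
qed

lemma norm_pmat_le: "norm (pmat p) \<le> (real CARD('n))\<^sup>2" for p :: "'n::finite proj"
proof -
  obtain u where u: "u \<noteq> 0" "p = pt u" using pt_surj by blast
  have "norm (projector u $ i $ j) \<le> 1" for i j
  proof -
    have "norm (u $ i) * norm (u $ j) \<le> norm u * norm u"
      by (intro mult_mono Finite_Cartesian_Product.norm_nth_le) auto
    then show ?thesis using u
      by (simp add: projector_def sum_mult_cnj norm_divide norm_mult power2_eq_square divide_le_eq)
  qed
  then show ?thesis using norm_matrix_le[of "projector u" 1] u pmat_pt[of u] by simp
qed

text \<open>The derivative is only real linear, because of the conjugates. Bounding the terms of the
  quotient rule one by one would involve the size of the derivative of the lift, which depends on
  the lift; they have to be combined before estimating.\<close>

lemma pmat_has_derivative: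
  fixes f :: "complex \<Rightarrow> 'n::finite proj"
  assumes "proj_lift f z G"
  shows "\<exists>D. ((\<lambda>t. pmat (f t) $ i $ j) has_derivative D) (at z) \<and>
    (\<forall>h. norm (D h) \<le> 2 * real CARD('n) * proj_speed f z * norm h)"
proof -
  obtain N where N: "open N" "z \<in> N" "vec_holomorphic_on G N" "\<And>t. t \<in> N \<Longrightarrow> G t \<noteq> 0 \<and> f t = pt (G t)"
    using assms unfolding proj_lift_def by blast
  define u where "u = G z"
  define w where "w = vderiv G z"
  let ?S = "\<Sum>k\<in>UNIV. u $ k * cnj (u $ k)"
  have u0: "u \<noteq> 0" using N(4)[OF N(2)] by (simp add: u_def)
  then have S0: "?S \<noteq> 0" by (simp add: sum_mult_cnj)
  have dG: "((\<lambda>t. G t $ k) has_derivative (\<lambda>h. w $ k * h)) (at z)" for k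
    using N(1-3) holomorphic_derivI[of "\<lambda>t. G t $ k" N z UNIV]
    by (simp add: vec_holomorphic_on_def w_def vderiv_def has_field_derivative_def)
  have dC: "((\<lambda>t. cnj (G t $ k)) has_derivative (\<lambda>h. cnj (w $ k * h))) (at z)" for k
    using has_derivative_cnj[OF dG] .
  define D where "D h = ((u $ i * cnj (w $ j * h) + w $ i * h * cnj (u $ j)) * ?S -
      u $ i * cnj (u $ j) * (\<Sum>k\<in>UNIV. u $ k * cnj (w $ k * h) + w $ k * h * cnj (u $ k))) / (?S * ?S)" for h
  have "((\<lambda>t. G t $ i * cnj (G t $ j) / (\<Sum>k\<in>UNIV. G t $ k * cnj (G t $ k))) has_derivative D) (at z)"
    unfolding D_def u_def
    by (intro has_derivative_divide' has_derivative_mult has_derivative_sum dG dC)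
       (use S0 in \<open>simp add: u_def\<close>)
  then have "((\<lambda>t. pmat (f t) $ i $ j) has_derivative D) (at z)"
    by (rule has_derivative_transform_within_open[OF _ N(1,2)]) (use N(4) in \<open>simp add: pmat_pt projector_def\<close>)
  moreover have "norm (D h) \<le> 2 * real CARD('n) * proj_speed f z * norm h" for h
  proof -
    \<comment> \<open>Regrouped by \<open>k\<close>, the numerator of the quotient rule is a sum of
      terms each containing an entry of \<open>wedge u w\<close> or its conjugate. Two such terms
      for each index explain the constant \<open>2 * CARD('n)\<close>.\<close>
    let ?a = "\<lambda>k. h * cnj (u $ j) * cnj (u $ k) * (u $ k * w $ i - u $ i * w $ k)"
    let ?b = "\<lambda>k. cnj h * u $ i * u $ k * cnj (u $ k * w $ j - u $ j * w $ k)"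
    have bnd: "norm (h' * p * q * x) \<le> norm h * norm u * norm u * norm (wedge u w)"
      if "norm h' = norm h" "norm p \<le> norm u" "norm q \<le> norm u" "norm x \<le> norm (wedge u w)" for h' p q x :: complex
      unfolding norm_mult that(1) by (intro mult_mono that mult_nonneg_nonneg norm_ge_zero order.refl)
    have "D h = (\<Sum>k\<in>UNIV. ?a k + ?b k) / (?S * ?S)"
      unfolding D_def sum_distrib_left sum_subtractf[symmetric]
      by (intro arg_cong[of _ _ "\<lambda>x. x / _"] sum.cong) (simp_all add: algebra_simps)
    then have Dh: "norm (D h) = norm (\<Sum>k\<in>UNIV. ?a k + ?b k) / (norm u)^4"
      by (simp add: norm_divide norm_mult sum_mult_cnj power4_eq_xxxx power2_eq_square)
    have "norm (\<Sum>k\<in>UNIV. ?a k + ?b k) \<le> (\<Sum>k\<in>(UNIV::'n set). 2 * (norm h * norm u * norm u * norm (wedge u w)))"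
    proof (rule order.trans[OF norm_sum], rule sum_mono)
      fix k
      have "norm (?a k) \<le> norm h * norm u * norm u * norm (wedge u w)"
        by (rule bnd; simp only: complex_mod_cnj Finite_Cartesian_Product.norm_nth_le wedge_component_le)
      moreover have "norm (?b k) \<le> norm h * norm u * norm u * norm (wedge u w)"
        by (rule bnd; simp only: complex_mod_cnj Finite_Cartesian_Product.norm_nth_le wedge_component_le)
      ultimately show "norm (?a k + ?b k) \<le> 2 * (norm h * norm u * norm u * norm (wedge u w))"
        using norm_triangle_ineq[of "?a k" "?b k"] by linarith
    qed
    then have "norm (D h) \<le> (2 * real CARD('n) * norm h * norm u * norm u * norm (wedge u w)) / (norm u)^4"
      unfolding Dh by (intro divide_right_mono) (simp_all add: mult.assoc)
    also have "\<dots> = 2 * real CARD('n) * fs_norm u w * norm h"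
      using u0 by (simp add: fs_norm_def power4_eq_xxxx power2_eq_square)
    also have "fs_norm u w = proj_speed f z" using proj_speed_eq[OF assms] by (simp add: u_def w_def)
    finally show ?thesis .
  qed
  ultimately show ?thesis by blast
qed

text \<open>The mean value inequality, on a convex set, is applied to each entry. The third power of
  \<open>CARD('n)\<close> consists of one factor from the derivative of an entry and two from
  passing from entries to the norm of the matrix.\<close>

lemma pmat_lipschitz:
  fixes f :: "complex \<Rightarrow> 'n::finite proj"
  assumes "open S" "convex S" "proj_holomorphic_on f S" "\<And>z. z \<in> S \<Longrightarrow> proj_speed f z \<le> L" "s \<in> S" "t \<in> S"
  shows "norm (pmat (f s) - pmat (f t)) \<le> 2 * (real CARD('n))^3 * L * norm (s - t)"
proof -
  let ?B = "2 * real CARD('n) * L"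
  have "norm ((pmat (f s) - pmat (f t)) $ i $ j) \<le> ?B * norm (s - t)" for i j
  proof -
    have "\<forall>z. \<exists>D. z \<in> S \<longrightarrow> ((\<lambda>t. pmat (f t) $ i $ j) has_derivative D) (at z) \<and>
       (\<forall>h. norm (D h) \<le> 2 * real CARD('n) * proj_speed f z * norm h)"
      using assms(1,3) proj_holomorphic_on_open pmat_has_derivative by metis
    then obtain D where D: "\<And>z. z \<in> S \<Longrightarrow> ((\<lambda>t. pmat (f t) $ i $ j) has_derivative D z) (at z)"
       "\<And>z h. z \<in> S \<Longrightarrow> norm (D z h) \<le> 2 * real CARD('n) * proj_speed f z * norm h"
      by metis
    have "norm (pmat (f s) $ i $ j - pmat (f t) $ i $ j) \<le> ?B * norm (s - t)"
    proof (rule differentiable_bound[OF assms(2) _ _ assms(5,6)])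
      fix z assume z: "z \<in> S"
      show "((\<lambda>t. pmat (f t) $ i $ j) has_derivative D z) (at z within S)"
        using D(1)[OF z] has_derivative_at_withinI by blast
      show "onorm (D z) \<le> ?B"
      proof (rule onorm_le)
        fix h
        have "norm (D z h) \<le> 2 * real CARD('n) * proj_speed f z * norm h" using D(2)[OF z] .
        also have "\<dots> \<le> ?B * norm h" using assms(4)[OF z] by (intro mult_right_mono mult_left_mono) auto
        finally show "norm (D z h) \<le> ?B * norm h" .
      qed
    qed
    then show ?thesis by simp
  qed
  then have "norm (pmat (f s) - pmat (f t)) \<le> (real CARD('n))\<^sup>2 * (?B * norm (s - t))"
    by (rule norm_matrix_le)
  then show ?thesis by (simp add: power2_eq_square power3_eq_cube algebra_simps)
qed

section \<open>Limits of rescaled curves\<close>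

text \<open>This is the point selection of Brody and Zalcman. Of the conclusions, the bound for
  \<open>\<rho> a' * e'\<close> makes the rescaled discs grow,
  \<open>\<rho> a \<le> \<rho> a'\<close> makes the scaling factors small, and the last one bounds
  the rescaled speeds by 2.\<close>

lemma rescaling_centre:
  fixes \<rho> :: "complex \<Rightarrow> real"
  assumes cont: "continuous_on (cball a e) \<rho>" and "0 < e" "0 < \<rho> a"
  obtains a' e' where "0 < e'" "cball a' e' \<subseteq> cball a e" "\<rho> a * e \<le> 2 * \<rho> a' * e'" "\<rho> a \<le> \<rho> a'"
    "\<And>z. z \<in> cball a' e' \<Longrightarrow> \<rho> z \<le> 2 * \<rho> a'"
proof -
  let ?\<phi> = "\<lambda>z. \<rho> z * (e - dist a z)"
  have "continuous_on (cball a e) ?\<phi>" by (intro continuous_intros cont)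
  then have "\<exists>x\<in>cball a e. \<forall>z\<in>cball a e. ?\<phi> z \<le> ?\<phi> x"
    using assms(2) by (intro continuous_attains_sup) auto
  then obtain a' where a': "a' \<in> cball a e" "\<And>z. z \<in> cball a e \<Longrightarrow> ?\<phi> z \<le> ?\<phi> a'"
    by blast
  \<comment> \<open>With half of the remaining distance as radius, every point of the new ball keeps
    distance at least \<open>e'\<close> from the old boundary, against \<open>2 * e'\<close> at
    \<open>a'\<close>. Maximality at \<open>a'\<close> turns this ratio into the factor 2 for
    \<open>\<rho>\<close>.\<close>
  define e' where "e' = (e - dist a a') / 2"
  have ea: "\<rho> a * e \<le> 2 * \<rho> a' * e'" using a'(2)[of a] assms(2) by (simp add: e'_def)
  moreover have "0 < \<rho> a * e" using assms(2,3) by simp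
  ultimately have pos: "0 < \<rho> a' * e'" by (simp add: mult.assoc)
  have "0 \<le> e'" using a'(1) by (simp add: e'_def)
  with pos have e': "0 < e'" by (cases "e' = 0") auto
  have ge: "e' \<le> e - dist a z" if "z \<in> cball a' e'" for z
    using that dist_triangle[of a z a'] by (simp add: e'_def field_simps)
  have sub: "cball a' e' \<subseteq> cball a e" using ge e' by force
  have "\<rho> z \<le> 2 * \<rho> a'" if z: "z \<in> cball a' e'" for z
  proof (cases "\<rho> z \<le> 0")
    case True
    then show ?thesis using zero_less_mult_pos2[OF pos e'] by linarith
  next
    case False
    then have "\<rho> z * e' \<le> ?\<phi> z" using ge[OF z] by (intro mult_left_mono) auto
    also have "\<dots> \<le> 2 * \<rho> a' * e'" using a'(2)[of z] sub z by (auto simp: e'_def)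
    finally show ?thesis using e' by simp
  qed
  moreover have "\<rho> a \<le> \<rho> a'"
  proof -
    have "\<rho> a * e \<le> \<rho> a' * (2 * e')" using ea by (simp add: algebra_simps)
    also have "\<dots> \<le> \<rho> a' * e"
      using zero_less_mult_pos2[OF pos e'] by (intro mult_left_mono) (auto simp: e'_def)
    finally show ?thesis using assms(2) by simp
  qed
  ultimately show ?thesis using that e' sub ea by blast
qed

section \<open>Recovering points and holomorphic lifts from projection matrices\<close>

definition chart_col :: "'n \<Rightarrow> complex^'n^'n \<Rightarrow> complex^'n" where
  "chart_col j A = (\<chi> i. A $ i $ j / A $ j $ j)"

lemma pmat_pt_nth:
  assumes "v \<noteq> 0"
  shows "pmat (pt v) $ i $ j = v $ i * cnj (v $ j) / of_real ((norm v)\<^sup>2)"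
  using assms by (simp add: pmat_pt projector_def sum_mult_cnj)

lemma pmat_diagonal_nonzero: "\<exists>j. pmat p $ j $ j \<noteq> 0"
proof -
  obtain v where v: "v \<noteq> 0" "p = pt v" using pt_surj by blast
  then obtain j where "v $ j \<noteq> 0" by (auto simp: vec_eq_iff)
  then show ?thesis using v by (auto simp: pmat_pt_nth intro!: exI[of _ j])
qed

text \<open>Column \<open>j\<close> of the projection is a multiple of \<open>v\<close>, and
  division by the diagonal entry cancels the conjugate and the norm. What remains is the
  representative with coordinate \<open>j\<close> equal to 1, so these are the usual affine
  coordinates.\<close>

lemma chart_col_pmat_pt:
  fixes v :: "complex^'n"
  assumes "v \<noteq> 0" "v $ j \<noteq> 0"
  shows "chart_col j (pmat (pt v)) = inverse (v $ j) *s v"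
  using assms by (simp add: chart_col_def pmat_pt_nth vec_eq_iff field_simps)

lemma chart_col_nonzero: "(A :: complex^'n^'n) $ j $ j \<noteq> 0 \<Longrightarrow> chart_col j A \<noteq> 0"
  by (auto simp: chart_col_def vec_eq_iff intro!: exI[of _ j])

lemma pt_chart_col:
  assumes "pmat p $ j $ j \<noteq> 0"
  shows "p = pt (chart_col j (pmat p))"
proof -
  obtain v where v: "v \<noteq> 0" "p = pt v" using pt_surj by blast
  then have "v $ j \<noteq> 0" using assms by (auto simp: pmat_pt_nth)
  then show ?thesis using v chart_col_pmat_pt[of v j] pt_scale[of "inverse (v $ j)" v] by simp
qed

text \<open>The embedded projective space is the image of the unit sphere under a continuous map,
  hence compact and closed.\<close>

lemma pmat_limit:
  fixes p :: "nat \<Rightarrow> 'n::finite proj"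
  assumes "(\<lambda>k. pmat (p k)) \<longlonglongrightarrow> A"
  shows "\<exists>q. A = pmat q"
proof -
  have "continuous_on (sphere 0 1) (projector :: complex^'n \<Rightarrow> _)"
    unfolding projector_def
    by (intro continuous_on_vec_lambda continuous_intros) (auto simp: sum_mult_cnj)
  then have "compact (projector ` (sphere 0 1 :: (complex^'n) set))"
    by (intro compact_continuous_image) auto
  then have cl: "closed (projector ` (sphere 0 1 :: (complex^'n) set))" by (rule compact_imp_closed)
  have "pmat (p k) \<in> projector ` sphere 0 1" for k
  proof -
    obtain v where v: "norm v = 1" "p k = pt v" using pt_surj_unit by blast
    then have "pmat (p k) = projector v" by (metis pmat_pt norm_zero zero_neq_one)
    then show ?thesis using v by auto
  qed
  then have "A \<in> projector ` (sphere 0 1 :: (complex^'n) set)"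
    by (rule closed_sequentially[OF cl _ assms])
  then obtain v :: "complex^'n" where "norm v = 1" "A = projector v" by auto
  then show ?thesis by (metis pmat_pt norm_zero zero_neq_one)
qed

lemma tendsto_chart_col:
  fixes A :: "complex^'n^'n"
  assumes "(X \<longlongrightarrow> A) F" "A $ j $ j \<noteq> 0"
  shows "((\<lambda>k. chart_col j (X k)) \<longlongrightarrow> chart_col j A) F"
  unfolding chart_col_def by (intro tendsto_vec_lambda tendsto_divide tendsto_vec_nth assms)

text \<open>Convergence of matrices is turned into convergence of vectors in the cone, the form that
  \<open>bizclosed_limit\<close> accepts. A coordinate that is nonzero at the limit is eventually
  nonzero along the sequence and serves for normalisation.\<close>

lemma pmat_tendsto_lift:
  assumes "(\<lambda>k. pmat (p k)) \<longlonglongrightarrow> pmat q"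
  obtains u v where "v \<noteq> 0" "q = pt v" "u \<longlonglongrightarrow> v" "\<forall>\<^sub>F k in sequentially. u k \<noteq> 0 \<and> p k = pt (u k)"
proof -
  obtain j where j: "pmat q $ j $ j \<noteq> 0" using pmat_diagonal_nonzero by blast
  have "(\<lambda>k. pmat (p k) $ j $ j) \<longlonglongrightarrow> pmat q $ j $ j" by (intro tendsto_vec_nth assms)
  then have "\<forall>\<^sub>F k in sequentially. pmat (p k) $ j $ j \<noteq> 0" using j by (rule tendsto_imp_eventually_ne)
  then have "\<forall>\<^sub>F k in sequentially. chart_col j (pmat (p k)) \<noteq> 0 \<and> p k = pt (chart_col j (pmat (p k)))"
    by eventually_elim (use pt_chart_col chart_col_nonzero in blast)
  then show ?thesis
    using that[of "chart_col j (pmat q)" "\<lambda>k. chart_col j (pmat (p k))"] j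
      tendsto_chart_col[OF assms j] pt_chart_col[OF j] chart_col_nonzero[OF j] by blast
qed

text \<open>Near each point the entries are quotients of coordinates of a local lift. The
  normalisation makes them independent of the lift, so one vector function lifts \<open>f\<close> on
  all of \<open>S\<close>.\<close>

lemma vec_holomorphic_on_chart_col:
  fixes f :: "complex \<Rightarrow> 'n::finite proj"
  assumes "open S" "proj_holomorphic_on f S" "\<And>t. t \<in> S \<Longrightarrow> pmat (f t) $ j $ j \<noteq> 0"
  shows "vec_holomorphic_on (\<lambda>t. chart_col j (pmat (f t))) S"
  unfolding vec_holomorphic_on_def holomorphic_on_def
proof (intro allI ballI)
  fix i z assume z: "z \<in> S"
  then obtain G where "proj_lift f z G" using assms proj_holomorphic_on_open by blast
  then obtain N where N: "open N" "z \<in> N" "vec_holomorphic_on G N" "\<And>t. t \<in> N \<Longrightarrow> G t \<noteq> 0 \<and> f t = pt (G t)"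
    unfolding proj_lift_def by blast
  have nz: "G t $ j \<noteq> 0" if "t \<in> N \<inter> S" for t
    using that assms(3)[of t] N(4)[of t] pmat_pt_nth[of "G t" j j] by auto
  have eq: "G t $ i / G t $ j = chart_col j (pmat (f t)) $ i" if "t \<in> N \<inter> S" for t
    using chart_col_pmat_pt[of "G t" j] nz[OF that] N(4)[of t] that by (simp add: field_simps)
  have "(\<lambda>t. G t $ i / G t $ j) holomorphic_on N \<inter> S"
    using N(3) nz unfolding vec_holomorphic_on_def
    by (intro holomorphic_on_divide) (auto intro: holomorphic_on_subset)
  then have "(\<lambda>t. chart_col j (pmat (f t)) $ i) holomorphic_on N \<inter> S"
    by (rule holomorphic_transform) (rule eq)
  then show "(\<lambda>t. chart_col j (pmat (f t)) $ i) field_differentiable at z within S"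
    using z N(1,2) assms(1) holomorphic_on_imp_differentiable_at field_differentiable_at_within
    by (metis IntI open_Int)
qed

lemma proj_lift_chart_col:
  assumes "open S" "z \<in> S" "proj_holomorphic_on f S" "\<And>t. t \<in> S \<Longrightarrow> pmat (f t) $ j $ j \<noteq> 0"
  shows "proj_lift f z (\<lambda>t. chart_col j (pmat (f t)))"
  unfolding proj_lift_def
  by (rule exI[of _ S])
     (simp add: assms vec_holomorphic_on_chart_col pt_chart_col[symmetric] chart_col_nonzero)

lemma continuous_on_pmat:
  assumes "open S" "proj_holomorphic_on f S"
  shows "continuous_on S (\<lambda>t. pmat (f t) $ i $ j)"
proof (rule continuous_at_imp_continuous_on, intro ballI)
  fix z assume "z \<in> S"
  then obtain G where "proj_lift f z G" using assms proj_holomorphic_on_open by blast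
  then show "isCont (\<lambda>t. pmat (f t) $ i $ j) z"
    using pmat_has_derivative has_derivative_continuous by blast
qed

lemma tendsto_fs_norm:
  assumes "(u \<longlongrightarrow> u0) F" "(w \<longlongrightarrow> w0) F" "u0 \<noteq> 0"
  shows "((\<lambda>k. fs_norm (u k) (w k)) \<longlongrightarrow> fs_norm u0 w0) F"
  unfolding fs_norm_def wedge_def
  by (intro tendsto_divide tendsto_norm tendsto_power tendsto_vec_lambda tendsto_diff tendsto_mult tendsto_vec_nth assms)
     (use assms in auto)

text \<open>The domains vary with \<open>k\<close>, so Arzela--Ascoli is used on every disc of
  integer radius, followed by a diagonal argument; each such disc lies in all but finitely many
  domains.\<close>

lemma convergent_pmat_subsequence:
  fixes f :: "nat \<Rightarrow> complex \<Rightarrow> 'n::finite proj"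
  assumes R: "filterlim R at_top sequentially"
    and hol: "\<And>k. proj_holomorphic_on (f k) (ball 0 (R k))"
    and speed: "\<And>k z. z \<in> ball 0 (R k) \<Longrightarrow> proj_speed (f k) z \<le> L"
  obtains r Q where "strict_mono r" "\<And>\<rho>. uniform_limit (cball 0 \<rho>) (\<lambda>k t. pmat (f (r k) t)) Q sequentially"
proof -
  \<comment> \<open>Curves not yet defined on the disc of radius \<open>i\<close> are replaced by
    the zero matrix, which obeys the same bounds; the family is thus uniformly bounded and
    equicontinuous for all \<open>n\<close>.\<close>
  define H where "H i n z = (if R n > real i then pmat (f n z) else 0)" for i n z
  define P where "P i s \<longleftrightarrow> (\<exists>g. uniform_limit (cball 0 (real i)) (\<lambda>k. H i (s k)) g sequentially)"
    for i and s :: "nat \<Rightarrow> nat"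
  \<comment> \<open>The summand 1 makes the constant positive, so that \<open>e / ?C\<close> is an
    admissible modulus of continuity.\<close>
  let ?C = "2 * (real CARD('n))^3 * \<bar>L\<bar> + 1"
  have lip: "norm (H i n x - H i n y) \<le> ?C * norm (x - y)" if "x \<in> cball 0 (real i)" "y \<in> cball 0 (real i)" for i n x y
  proof (cases "R n > real i")
    case True
    then have "norm (pmat (f n x) - pmat (f n y)) \<le> 2 * (real CARD('n))^3 * \<bar>L\<bar> * norm (x - y)"
      using that order.trans[OF speed abs_ge_self]
      by (intro pmat_lipschitz[OF _ _ hol]) auto
    also have "\<dots> \<le> ?C * norm (x - y)" by (intro mult_right_mono) auto
    finally show ?thesis using True by (simp add: H_def)
  next
    case False
    then show ?thesis by (simp add: H_def)
  qed
  have sub: "\<exists>k. strict_mono k \<and> P i (s \<circ> k)" for i and s :: "nat \<Rightarrow> nat"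
  proof -
    obtain g k where gk: "strict_mono (k :: nat \<Rightarrow> nat)"
      "\<And>e. 0 < e \<Longrightarrow> \<exists>N. \<forall>n x. n \<ge> N \<and> x \<in> cball 0 (real i) \<longrightarrow> norm (H i (s (k n)) x - g x) < e"
    proof (rule Arzela_Ascoli[of "cball 0 (real i)" "\<lambda>n. H i (s n)" "(real CARD('n))\<^sup>2"])
      show "norm (H i (s n) x) \<le> (real CARD('n))\<^sup>2" for n x
        using norm_pmat_le[of "f (s n) x"] by (simp add: H_def)
      show "\<exists>d>0. \<forall>n y. y \<in> cball 0 (real i) \<and> norm (x - y) < d \<longrightarrow> norm (H i (s n) x - H i (s n) y) < e"
        if "x \<in> cball 0 (real i)" "0 < e" for x e
      proof (intro exI[of _ "e / ?C"] conjI allI impI)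
        have C: "0 < ?C" by (simp add: add_nonneg_pos)
        then show "0 < e / ?C" using that by simp
        fix n y assume y: "y \<in> cball 0 (real i) \<and> norm (x - y) < e / ?C"
        have "norm (H i (s n) x - H i (s n) y) \<le> ?C * norm (x - y)" using lip that y by blast
        also have "\<dots> < e" using y C by (simp add: pos_less_divide_eq mult.commute)
        finally show "norm (H i (s n) x - H i (s n) y) < e" .
      qed
    qed auto
    have "uniform_limit (cball 0 (real i)) (\<lambda>n. H i (s (k n))) g sequentially"
      unfolding uniform_limit_sequentially_iff dist_norm using gk(2) by blast
    then show ?thesis using gk(1) by (auto simp: P_def o_def)
  qed
  \<comment> \<open>The diagonal sequence is a subsequence of the sequence chosen at stage
    \<open>i\<close> only from some index on, so convergence must survive changes of finitely many
    terms.\<close>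
  have PP: "P i (s \<circ> k2)" if k1: "P i (s \<circ> k1)" and k2: "\<And>j. N \<le> j \<Longrightarrow> \<exists>j'. j \<le> j' \<and> k2 j = k1 j'" for i N and s k1 k2 :: "nat \<Rightarrow> nat"
  proof -
    obtain g where g: "uniform_limit (cball 0 (real i)) (\<lambda>k. H i ((s \<circ> k1) k)) g sequentially"
      using k1 by (auto simp: P_def)
    have "uniform_limit (cball 0 (real i)) (\<lambda>k. H i ((s \<circ> k2) k)) g sequentially"
      unfolding uniform_limit_sequentially_iff
    proof (intro allI impI)
      fix e :: real assume "0 < e"
      then obtain M where M: "\<forall>n\<ge>M. \<forall>x\<in>cball 0 (real i). dist (H i ((s \<circ> k1) n) x) (g x) < e"
        using g unfolding uniform_limit_sequentially_iff by blast
      show "\<exists>M. \<forall>n\<ge>M. \<forall>x\<in>cball 0 (real i). dist (H i ((s \<circ> k2) n) x) (g x) < e"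
      proof (intro exI[of _ "max M N"] allI impI)
        fix n assume "max M N \<le> n"
        then obtain j' where "n \<le> j'" "k2 n = k1 j'" using k2[of n] by auto
        then show "\<forall>x\<in>cball 0 (real i). dist (H i ((s \<circ> k2) n) x) (g x) < e"
          using M \<open>max M N \<le> n\<close> by simp
      qed
    qed
    then show ?thesis by (auto simp: P_def)
  qed
  obtain r where r: "strict_mono (r :: nat \<Rightarrow> nat)" "\<And>i. P i (id \<circ> r)"
    by (rule subsequence_diagonalization_lemma[of P id]) (use sub PP in blast)+
  \<comment> \<open>Limits on different discs are forced to agree by pointwise uniqueness, so the
    pointwise limit glues them to one function.\<close>
  define Q where "Q z = lim (\<lambda>k. pmat (f (r k) z))" for z
  have ulim: "uniform_limit (cball 0 (real i)) (\<lambda>k t. pmat (f (r k) t)) Q sequentially" for i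
  proof -
    obtain g where g: "uniform_limit (cball 0 (real i)) (\<lambda>k. H i (r k)) g sequentially"
      using r(2)[of i] by (auto simp: P_def)
    have "\<forall>\<^sub>F k in sequentially. R k > real i" using R by (simp add: filterlim_at_top_dense)
    then have "\<forall>\<^sub>F k in sequentially. R (r k) > real i"
      using eventually_subseq[OF r(1)] by blast
    then have "\<forall>\<^sub>F k in sequentially. \<forall>t\<in>cball 0 (real i). H i (r k) t = pmat (f (r k) t)"
      by eventually_elim (simp add: H_def)
    then have ug: "uniform_limit (cball 0 (real i)) (\<lambda>k t. pmat (f (r k) t)) g sequentially"
      using g by (subst (asm) uniform_limit_cong) auto
    moreover have "g t = Q t" if "t \<in> cball 0 (real i)" for t
      using tendsto_uniform_limitI[OF ug that] by (simp add: Q_def limI)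
    ultimately show ?thesis by (subst (asm) uniform_limit_cong') auto
  qed
  have "uniform_limit (cball 0 \<rho>) (\<lambda>k t. pmat (f (r k) t)) Q sequentially" for \<rho>
  proof -
    obtain i :: nat where "\<rho> \<le> real i" using real_arch_simple by blast
    then show ?thesis by (intro uniform_limit_on_subset[OF ulim[of i]]) auto
  qed
  then show ?thesis using that r(1) by blast
qed

text \<open>Near \<open>z\<close> an affine chart is fixed by a diagonal entry of the limit matrix
  that stays away from zero. In it the curves become holomorphic vector functions that converge
  uniformly, hence with their derivatives, and the speed is continuous in both.\<close>

lemma limit_curve:
  fixes F :: "nat \<Rightarrow> complex \<Rightarrow> 'n::finite proj"
  assumes ulim: "\<And>\<rho>. uniform_limit (cball 0 \<rho>) (\<lambda>k t. pmat (F k t)) Q sequentially"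
    and hol: "\<And>\<rho>. \<forall>\<^sub>F k in sequentially. proj_holomorphic_on (F k) (ball 0 \<rho>)"
  obtains f where "proj_holomorphic_on f UNIV" "\<And>t. (\<lambda>k. pmat (F k t)) \<longlonglongrightarrow> pmat (f t)"
    "\<And>t. (\<lambda>k. proj_speed (F k) t) \<longlonglongrightarrow> proj_speed f t"
proof -
  have lim: "(\<lambda>k. pmat (F k t)) \<longlonglongrightarrow> Q t" for t
    by (rule tendsto_uniform_limitI[OF ulim[of "norm t"]]) auto
  have "\<exists>f. \<forall>t. Q t = pmat (f t)" using pmat_limit[OF lim] by (intro choice) auto
  then obtain f where f: "\<And>t. Q t = pmat (f t)" by blast
  have ulim_nth: "uniform_limit (cball 0 \<rho>) (\<lambda>k t. pmat (F k t) $ i $ j) (\<lambda>t. Q t $ i $ j) sequentially" for \<rho> i j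
  proof -
    have "bounded_linear (\<lambda>A::complex^'n^'n. A $ i $ j)"
      using bounded_linear_compose[OF bounded_linear_vec_nth bounded_linear_vec_nth] .
    then show ?thesis by (rule bounded_linear.uniform_limit[OF _ ulim])
  qed
  have contQ: "continuous_on UNIV (\<lambda>t. Q t $ i $ j)" for i j
  proof (rule continuous_at_imp_continuous_on, intro ballI)
    fix t :: complex
    let ?B = "cball 0 (norm t + 1)"
    have "\<forall>\<^sub>F k in sequentially. continuous_on ?B (\<lambda>t. pmat (F k t) $ i $ j)"
      using hol[of "norm t + 2"]
    proof eventually_elim
      case (elim k)
      have "?B \<subseteq> ball 0 (norm t + 2)" by (auto simp: dist_norm)
      then show ?case using continuous_on_subset[OF continuous_on_pmat[OF open_ball elim]] by blast
    qed
    then have "continuous_on ?B (\<lambda>t. Q t $ i $ j)"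
      using uniform_limit_theorem[OF _ ulim_nth] by auto
    moreover have "t \<in> interior ?B" by simp
    ultimately show "isCont (\<lambda>t. Q t $ i $ j) t" using continuous_on_interior by blast
  qed
  have local: "\<exists>G. proj_lift f z G \<and> (\<lambda>k. proj_speed (F k) z) \<longlonglongrightarrow> fs_norm (G z) (vderiv G z)" for z
  proof -
    obtain j where j: "Q z $ j $ j \<noteq> 0" using pmat_diagonal_nonzero[of "f z"] f by auto
    \<comment> \<open>Half the value at \<open>z\<close> leaves room twice: the limit entry stays at
      least \<open>b\<close> in norm near \<open>z\<close>, and entries of curves closer than
      \<open>b\<close> to it are nonzero.\<close>
    define b where "b = norm (Q z $ j $ j) / 2"
    have b: "0 < b" using j by (simp add: b_def)
    have "isCont (\<lambda>t. norm (Q t $ j $ j)) z"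
      using contQ[of j j] by (simp add: continuous_on_eq_continuous_at)
    then obtain e0 where e0: "0 < e0" "\<And>t. dist t z < e0 \<Longrightarrow> dist (norm (Q t $ j $ j)) (norm (Q z $ j $ j)) < b"
      using b unfolding continuous_at_eps_delta by blast
    \<comment> \<open>The cap 1 keeps the disc inside the ball of radius \<open>norm z + 1\<close>,
      where the curves are eventually holomorphic.\<close>
    define e where "e = min e0 1"
    have e: "0 < e" using e0 by (simp add: e_def)
    have Qb: "b \<le> norm (Q t $ j $ j)" if "t \<in> ball z e" for t
    proof -
      have "dist t z < e0" using that by (simp add: e_def dist_commute)
      then have "\<bar>norm (Q t $ j $ j) - 2 * b\<bar> < b" using e0(2)[of t] by (simp add: b_def dist_real_def)
      then show ?thesis by linarith
    qed
    define \<rho> where "\<rho> = norm z + 1"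
    have sub: "ball z e \<subseteq> ball 0 \<rho>"
    proof
      fix t assume "t \<in> ball z e"
      then have "norm (t - z) < 1" by (simp add: e_def dist_norm norm_minus_commute)
      then show "t \<in> ball 0 \<rho>" using norm_triangle_sub[of t z] by (simp add: \<rho>_def)
    qed
    have ul: "uniform_limit (ball z e) (\<lambda>k t. pmat (F k t) $ i $ l) (\<lambda>t. Q t $ i $ l) sequentially" for i l
      by (rule uniform_limit_on_subset[OF ulim_nth[where \<rho> = \<rho>]]) (use sub ball_subset_cball[of 0 \<rho>] in blast)
    have "\<forall>\<^sub>F k in sequentially. \<forall>t\<in>ball z e. dist (pmat (F k t) $ j $ j) (Q t $ j $ j) < b"
      using uniform_limitD[OF ul b] .
    then have nz: "\<forall>\<^sub>F k in sequentially. \<forall>t\<in>ball z e. pmat (F k t) $ j $ j \<noteq> 0"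
      by eventually_elim (use Qb in \<open>fastforce simp: dist_norm\<close>)
    define h where "h k t = chart_col j (pmat (F k t))" for k t
    define g where "g t = chart_col j (Q t)" for t
    have hlift: "\<forall>\<^sub>F k in sequentially. proj_holomorphic_on (F k) (ball z e) \<and> (\<forall>t\<in>ball z e. pmat (F k t) $ j $ j \<noteq> 0)"
      using nz hol[of \<rho>]
    proof eventually_elim
      case (elim k)
      then show ?case using sub unfolding proj_holomorphic_on_open[OF open_ball] by blast
    qed
    have hu: "uniform_limit (ball z e) (\<lambda>k t. h k t $ i) (\<lambda>t. g t $ i) sequentially" for i
    proof -
      have "norm (Q t $ i $ j) \<le> (real CARD('n))\<^sup>2" for t
        using Finite_Cartesian_Product.norm_nth_le[of "Q t $ i" j] Finite_Cartesian_Product.norm_nth_le[of "Q t" i]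
          norm_pmat_le[of "f t"] f[of t] by simp
      then have "bounded ((\<lambda>t. Q t $ i $ j) ` ball z e)" by (intro boundedI) auto
      then show ?thesis
        unfolding h_def g_def chart_col_def vec_lambda_beta by (rule uniform_lim_divide[OF ul ul _ Qb b])
    qed
    \<comment> \<open>The theorem on limits of derivatives asks for continuity and uniform
      convergence on a closed disc, so a smaller one is taken.\<close>
    define d where "d = e / 2"
    have d: "0 < d" "cball z d \<subseteq> ball z e" using e by (auto simp: d_def)
    have hh: "\<forall>\<^sub>F k in sequentially. vec_holomorphic_on (h k) (ball z e)"
      using hlift
    proof eventually_elim
      case (elim k)
      then show ?case unfolding h_def by (intro vec_holomorphic_on_chart_col) auto
    qed
    have "\<exists>g'. (\<forall>w\<in>ball z d. ((\<lambda>t. g t $ i) has_field_derivative g' w) (at w)) \<and>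
        (\<lambda>k. deriv (\<lambda>t. h k t $ i) z) \<longlonglongrightarrow> g' z" for i
    proof -
      have ev: "\<forall>\<^sub>F k in sequentially. continuous_on (cball z d) (\<lambda>t. h k t $ i) \<and>
          (\<forall>w\<in>ball z d. ((\<lambda>t. h k t $ i) has_field_derivative deriv (\<lambda>t. h k t $ i) w) (at w))"
        using hh
      proof eventually_elim
        case (elim k)
        then have hk: "(\<lambda>t. h k t $ i) holomorphic_on ball z e" by (simp add: vec_holomorphic_on_def)
        then have "continuous_on (cball z d) (\<lambda>t. h k t $ i)"
          using d(2) holomorphic_on_imp_continuous_on continuous_on_subset by blast
        moreover have "ball z d \<subseteq> ball z e" using d(2) ball_subset_cball by blast
        ultimately show ?case using holomorphic_derivI[OF hk open_ball] by blast
      qed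
      have ud: "uniform_limit (cball z d) (\<lambda>k t. h k t $ i) (\<lambda>t. g t $ i) sequentially"
        by (rule uniform_limit_on_subset[OF hu d(2)])
      obtain g' where "\<And>w. w \<in> ball z d \<Longrightarrow> ((\<lambda>t. g t $ i) has_field_derivative (g' w)) (at w) \<and>
          (\<lambda>k. deriv (\<lambda>t. h k t $ i) w) \<longlonglongrightarrow> g' w"
        by (rule has_complex_derivative_uniform_limit[OF ev ud]) (use d(1) in auto)
      then show ?thesis using d(1) by (intro exI[of _ g']) auto
    qed
    then obtain g' where g': "\<And>i w. w \<in> ball z d \<Longrightarrow> ((\<lambda>t. g t $ i) has_field_derivative g' i w) (at w)"
        "\<And>i. (\<lambda>k. deriv (\<lambda>t. h k t $ i) z) \<longlonglongrightarrow> g' i z"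
      by metis
    have "vec_holomorphic_on g (ball z d)"
      unfolding vec_holomorphic_on_def using g'(1) holomorphic_on_open[OF open_ball] by blast
    moreover have "g t \<noteq> 0 \<and> f t = pt (g t)" if "t \<in> ball z d" for t
    proof -
      have "t \<in> ball z e" using that d(2) ball_subset_cball by blast
      then have "pmat (f t) $ j $ j \<noteq> 0" using Qb[of t] b f[of t] by auto
      then show ?thesis unfolding g_def f using pt_chart_col chart_col_nonzero by blast
    qed
    ultimately have lift: "proj_lift f z g"
      unfolding proj_lift_def using d(1) by (intro exI[of _ "ball z d"]) auto
    have "(\<lambda>k. vderiv (h k) z) \<longlonglongrightarrow> vderiv g z"
    proof -
      have "deriv (\<lambda>t. g t $ i) z = g' i z" for i using g'(1)[of z i] d(1) by (auto intro: DERIV_imp_deriv)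
      then show ?thesis unfolding vderiv_def using g'(2) by (intro tendsto_vec_lambda) simp
    qed
    moreover have "(\<lambda>k. h k z) \<longlonglongrightarrow> g z"
      unfolding h_def g_def by (rule tendsto_chart_col[OF lim j])
    ultimately have "(\<lambda>k. fs_norm (h k z) (vderiv (h k) z)) \<longlonglongrightarrow> fs_norm (g z) (vderiv g z)"
      using proj_lift_eq[OF lift] by (intro tendsto_fs_norm) auto
    moreover have "\<forall>\<^sub>F k in sequentially. fs_norm (h k z) (vderiv (h k) z) = proj_speed (F k) z"
      using hlift
    proof eventually_elim
      case (elim k)
      then have "proj_lift (F k) z (h k)"
        unfolding h_def using e by (intro proj_lift_chart_col[of "ball z e"]) auto
      then show ?case using proj_speed_eq by metis
    qed
    ultimately have "(\<lambda>k. proj_speed (F k) z) \<longlonglongrightarrow> fs_norm (g z) (vderiv g z)"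
      by (rule Lim_transform_eventually)
    then show ?thesis using lift by blast
  qed
  have "proj_holomorphic_on f UNIV" using local proj_holomorphic_on_open[OF open_UNIV] by blast
  moreover have "(\<lambda>k. proj_speed (F k) t) \<longlonglongrightarrow> proj_speed f t" for t
    using local[of t] proj_speed_eq by metis
  ultimately show ?thesis using that lim f by simp
qed

section \<open>Sections over a disc\<close>

lemma proj_speed_constant:
  assumes "f constant_on UNIV"
  shows "proj_speed f z = 0"
proof -
  obtain p where p: "\<And>t. f t = p" using assms by (auto simp: constant_on_def)
  obtain v where v: "v \<noteq> 0" "p = pt v" using pt_surj by blast
  have "proj_lift f z (\<lambda>_. v)"
    unfolding proj_lift_def using p v by (intro exI[of _ UNIV]) (auto simp: vec_holomorphic_on_def)
  then have "proj_speed f z = fs_norm v (vderiv (\<lambda>_. v) z)" by (rule proj_speed_eq)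
  also have "vderiv (\<lambda>_. v) z = 0" by (simp add: vderiv_def vec_eq_iff)
  also have "fs_norm v 0 = 0" by (simp add: fs_norm_def wedge_def zero_vec_def[symmetric])
  finally show ?thesis .
qed

lemma proj_lift_isCont:
  assumes "proj_lift f z G"
  shows "isCont G z"
proof -
  obtain N where N: "open N" "z \<in> N" "vec_holomorphic_on G N" using assms unfolding proj_lift_def by blast
  then have "isCont (\<lambda>t. G t $ i) z" for i
    using holomorphic_on_imp_continuous_on continuous_on_eq_continuous_at unfolding vec_holomorphic_on_def by blast
  then show ?thesis unfolding continuous_at by (intro vec_tendstoI)
qed

text \<open>The fibres are only known to be hyperbolic over \<open>K\<close>; rescaling near a point of \<open>K\<close> on discs
  of shrinking radius keeps the limit curve in a fibre over \<open>K\<close>.\<close>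

lemma bounded_speed_of_sections:
  fixes S :: "('n::finite proj \<times> 'm::finite proj) set"
  assumes S: "bizclosed S" and \<psi>: "proj_holomorphic_on \<psi> (ball 0 1)"
    and K: "compact K" "K \<subseteq> ball 0 1"
    and hyp: "\<And>z. z \<in> K \<Longrightarrow> brody_hyperbolic {p. (p, \<psi> z) \<in> S}"
  shows "\<exists>M. \<forall>g. proj_holomorphic_on g (ball 0 1) \<and> (\<forall>z\<in>ball 0 1. (g z, \<psi> z) \<in> S) \<longrightarrow>
    (\<forall>z\<in>K. proj_speed g z \<le> M)"
proof (rule ccontr)
  assume contra: "\<not> ?thesis"
  have "\<exists>g z. proj_holomorphic_on g (ball 0 1) \<and> (\<forall>z\<in>ball 0 1. (g z, \<psi> z) \<in> S) \<and> z \<in> K \<and>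
      (real (Suc k))\<^sup>2 < proj_speed g z" for k
    using contra not_le by metis
  then obtain g z where g: "\<And>k. proj_holomorphic_on (g k) (ball 0 1)" "\<And>k t. t \<in> ball 0 1 \<Longrightarrow> (g k t, \<psi> t) \<in> S"
    and z: "\<And>k. z k \<in> K" "\<And>k. (real (Suc k))\<^sup>2 < proj_speed (g k) (z k)"
    by metis
  obtain \<delta> where \<delta>: "0 < \<delta>" "(\<Union>x\<in>K. cball x \<delta>) \<subseteq> ball 0 1"
    using compact_subset_open_imp_cball_epsilon_subset[OF K(1) open_ball K(2)] .
  \<comment> \<open>The radii tend to zero, yet multiplied by speeds above
    \<open>(real (Suc k))\<^sup>2\<close> they still grow like
    \<open>\<delta> * real (Suc k)\<close>. This is why the speeds were chosen above a
    square.\<close>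
  define \<epsilon> where "\<epsilon> k = \<delta> / real (Suc k)" for k
  have \<epsilon>: "0 < \<epsilon> k" "cball (z k) (\<epsilon> k) \<subseteq> ball 0 1" for k
  proof -
    show "0 < \<epsilon> k" using \<delta>(1) by (simp add: \<epsilon>_def)
    have "\<epsilon> k \<le> \<delta>" using \<delta>(1) by (simp add: \<epsilon>_def divide_le_eq)
    then have "cball (z k) (\<epsilon> k) \<subseteq> cball (z k) \<delta>" by (rule subset_cball)
    also have "\<dots> \<subseteq> ball 0 1" using \<delta>(2) z(1)[of k] by blast
    finally show "cball (z k) (\<epsilon> k) \<subseteq> ball 0 1" .
  qed
  have "\<exists>a e. 0 < e \<and> cball a e \<subseteq> cball (z k) (\<epsilon> k) \<and>
      proj_speed (g k) (z k) * \<epsilon> k \<le> 2 * proj_speed (g k) a * e \<and>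
      proj_speed (g k) (z k) \<le> proj_speed (g k) a \<and>
      (\<forall>t\<in>cball a e. proj_speed (g k) t \<le> 2 * proj_speed (g k) a)" for k
  proof -
    have c: "continuous_on (cball (z k) (\<epsilon> k)) (proj_speed (g k))"
      using continuous_on_subset[OF continuous_on_proj_speed[OF open_ball g(1)] \<epsilon>(2)] .
    have p: "0 < proj_speed (g k) (z k)" using z(2)[of k] zero_le_power2[of "real (Suc k)"] by linarith
    show ?thesis by (rule rescaling_centre[OF c \<epsilon>(1) p]) blast
  qed
  then obtain a e where ae: "\<And>k. 0 < e k" "\<And>k. cball (a k) (e k) \<subseteq> cball (z k) (\<epsilon> k)"
      "\<And>k. proj_speed (g k) (z k) * \<epsilon> k \<le> 2 * proj_speed (g k) (a k) * e k"
      "\<And>k. proj_speed (g k) (z k) \<le> proj_speed (g k) (a k)"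
      "\<And>k t. t \<in> cball (a k) (e k) \<Longrightarrow> proj_speed (g k) t \<le> 2 * proj_speed (g k) (a k)"
    by metis
  define \<rho> where "\<rho> k = proj_speed (g k) (a k)" for k
  have \<rho>: "(real (Suc k))\<^sup>2 < \<rho> k" for k using z(2)[of k] ae(4)[of k] by (simp add: \<rho>_def)
  then have \<rho>pos: "0 < \<rho> k" for k using zero_le_power2[of "real (Suc k)"] by (meson le_less_trans)
  define c where "c k = complex_of_real (1 / \<rho> k)" for k
  have normc: "norm (c k) = 1 / \<rho> k" for k using \<rho>pos[of k] by (simp add: c_def norm_divide)
  \<comment> \<open>The substitution by \<open>c k\<close> takes the disc of this radius into the
    disc of radius \<open>e k\<close> around \<open>a k\<close>.\<close>
  define R where "R k = \<rho> k * e k" for k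
  have Rge: "\<delta> / 2 * real (Suc k) \<le> R k" for k
  proof -
    have "\<delta> * real (Suc k) = (real (Suc k))\<^sup>2 * \<epsilon> k" by (simp add: \<epsilon>_def power2_eq_square)
    also have "\<dots> \<le> proj_speed (g k) (z k) * \<epsilon> k"
      using z(2)[of k] \<epsilon>(1)[of k] by (intro mult_right_mono) auto
    also have "\<dots> \<le> 2 * R k" using ae(3)[of k] by (simp add: R_def \<rho>_def)
    finally show ?thesis by simp
  qed
  have Rlim: "filterlim R at_top sequentially"
  proof (rule filterlim_at_top_mono)
    show "filterlim (\<lambda>k. \<delta> / 2 * real (Suc k)) at_top sequentially"
      using \<delta>(1) by (intro filterlim_tendsto_pos_mult_at_top[OF tendsto_const]
          filterlim_compose[OF filterlim_real_sequentially filterlim_Suc]) auto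
  qed (use Rge in auto)
  define F where "F k t = g k (a k + c k * t)" for k t
  have inball: "a k + c k * t \<in> cball (a k) (e k)" if "t \<in> ball 0 (R k)" for k t
  proof -
    have "norm (c k * t) \<le> e k"
      using that \<rho>pos[of k] by (simp add: norm_mult normc R_def divide_le_eq mult.commute)
    then show ?thesis by (simp add: dist_norm)
  qed
  have liftF: "\<exists>G. proj_lift (g k) (a k + c k * t) G" if "t \<in> ball 0 (R k)" for k t
    using inball[OF that] ae(2)[of k] \<epsilon>(2)[of k] g(1)[of k] unfolding proj_holomorphic_on_open[OF open_ball] by blast
  have Fhol: "proj_holomorphic_on (F k) (ball 0 (R k))" for k
    unfolding proj_holomorphic_on_open[OF open_ball] F_def
    using liftF proj_lift_affine by blast
  have Fspeed: "proj_speed (F k) t = norm (c k) * proj_speed (g k) (a k + c k * t)" if "t \<in> ball 0 (R k)" for k t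
    using liftF[OF that] proj_speed_affine unfolding F_def by blast
  have Fspeed2: "proj_speed (F k) t \<le> 2" if "t \<in> ball 0 (R k)" for k t
  proof -
    have "proj_speed (g k) (a k + c k * t) \<le> 2 * \<rho> k" using ae(5)[OF inball[OF that]] by (simp add: \<rho>_def)
    then show ?thesis using Fspeed[OF that] \<rho>pos[of k] by (simp add: normc divide_le_eq)
  qed
  have Rpos: "0 < R k" for k using \<rho>pos[of k] ae(1)[of k] by (simp add: R_def)
  have Fspeed0: "proj_speed (F k) 0 = 1" for k
    using Fspeed[of 0 k] Rpos[of k] \<rho>pos[of k] by (simp add: normc \<rho>_def)
  \<comment> \<open>Two extractions are composed: this one makes the base points converge inside
    \<open>K\<close>, the next one makes the curves converge.\<close>
  obtain l r0 where l: "l \<in> K" "strict_mono r0" "(z \<circ> r0) \<longlonglongrightarrow> l"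
    using K(1) z(1) unfolding compact_def by metis
  have Rr0: "filterlim (R \<circ> r0) at_top sequentially"
    unfolding o_def by (rule filterlim_compose[OF Rlim filterlim_subseq[OF l(2)]])
  obtain r Q where r: "strict_mono r" "\<And>\<rho>. uniform_limit (cball 0 \<rho>) (\<lambda>k t. pmat ((F \<circ> r0) (r k) t)) Q sequentially"
    by (rule convergent_pmat_subsequence[OF Rr0, of "F \<circ> r0" 2]) (use Fhol Fspeed2 in auto)
  define s where "s = r0 \<circ> r"
  have s: "strict_mono s" unfolding s_def by (intro strict_mono_o l r)
  have ul: "uniform_limit (cball 0 \<rho>) (\<lambda>k t. pmat (F (s k) t)) Q sequentially" for \<rho>
    using r(2) by (simp add: s_def)
  have evhol: "\<forall>\<^sub>F k in sequentially. proj_holomorphic_on (F (s k)) (ball 0 d)" for d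
  proof -
    have "filterlim (\<lambda>k. R (s k)) at_top sequentially"
      by (rule filterlim_compose[OF Rlim filterlim_subseq[OF s]])
    then have "\<forall>\<^sub>F k in sequentially. d \<le> R (s k)" by (simp add: filterlim_at_top)
    then show ?thesis
    proof eventually_elim
      case (elim k)
      then have "ball 0 d \<subseteq> ball 0 (R (s k))" by (rule subset_ball)
      then show ?case using Fhol[of "s k"] unfolding proj_holomorphic_on_open[OF open_ball] by blast
    qed
  qed
  obtain f where f: "proj_holomorphic_on f UNIV" "\<And>t. (\<lambda>k. pmat (F (s k) t)) \<longlonglongrightarrow> pmat (f t)"
    "\<And>t. (\<lambda>k. proj_speed (F (s k)) t) \<longlonglongrightarrow> proj_speed f t"
    using limit_curve[OF ul evhol] by blast
  have "proj_speed f 0 = 1"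
    using f(3)[of 0] by (simp add: Fspeed0 LIMSEQ_const_iff)
  then have nonconst: "\<not> f constant_on UNIV" using proj_speed_constant[of f 0] by auto
  \<comment> \<open>For fixed \<open>t\<close> the base parameter has a limit independent of
    \<open>t\<close>: \<open>a k\<close> is within \<open>\<epsilon> k\<close> of
    \<open>z k\<close>, and \<open>c k\<close> is at most \<open>1 / real (Suc k)\<close> in norm.
    The limit curve therefore stays over the single point \<open>\<psi> l\<close>.\<close>
  have w: "(\<lambda>k. a (s k) + c (s k) * t) \<longlonglongrightarrow> l" for t
  proof -
    have zs: "(\<lambda>k. z (s k)) \<longlonglongrightarrow> l"
      using LIMSEQ_subseq_LIMSEQ[OF l(3) r(1)] by (simp add: s_def o_def)
    have "(\<lambda>k. inverse (real (Suc k)) * (\<delta> + norm t)) \<longlonglongrightarrow> 0 * (\<delta> + norm t)"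
      by (intro tendsto_mult LIMSEQ_inverse_real_of_nat tendsto_const)
    then have inv0: "(\<lambda>k. inverse (real (Suc (s k))) * (\<delta> + norm t)) \<longlonglongrightarrow> 0"
      using LIMSEQ_subseq_LIMSEQ[OF _ s] by (force simp: o_def)
    have bound: "norm (a k + c k * t - z k) \<le> inverse (real (Suc k)) * (\<delta> + norm t)" for k
    proof -
      have "a k \<in> cball (z k) (\<epsilon> k)" using ae(1,2)[of k] by (auto simp: subset_iff)
      then have 1: "norm (a k - z k) \<le> inverse (real (Suc k)) * \<delta>"
        by (simp add: dist_norm norm_minus_commute \<epsilon>_def field_simps)
      have "real (Suc k) \<le> (real (Suc k))\<^sup>2" by (simp add: power2_eq_square)
      then have "real (Suc k) \<le> \<rho> k" using \<rho>[of k] by linarith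
      then have "1 / \<rho> k \<le> inverse (real (Suc k))"
        using \<rho>pos[of k] by (simp add: inverse_eq_divide frac_le)
      then have "norm (c k * t) \<le> inverse (real (Suc k)) * norm t"
        unfolding norm_mult normc by (intro mult_right_mono) auto
      then show ?thesis
        using 1 norm_triangle_ineq[of "a k - z k" "c k * t"] by (simp add: algebra_simps)
    qed
    have "(\<lambda>k. a (s k) + c (s k) * t - z (s k)) \<longlonglongrightarrow> 0"
      by (rule tendsto_norm_zero_cancel, rule tendsto_sandwich[OF _ _ tendsto_const inv0])
         (use bound in auto)
    from tendsto_add[OF this zs] show ?thesis by simp
  qed
  have lball: "l \<in> ball 0 1" using l(1) K(2) by blast
  have "range f \<subseteq> {p. (p, \<psi> l) \<in> S}"
  proof clarify
    fix t
    obtain u v where uv: "v \<noteq> 0" "f t = pt v" "u \<longlonglongrightarrow> v" "\<forall>\<^sub>F k in sequentially. u k \<noteq> 0 \<and> F (s k) t = pt (u k)"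
      using pmat_tendsto_lift[OF f(2)] .
    obtain V where V: "proj_lift \<psi> l V" using \<psi> lball proj_holomorphic_on_open[OF open_ball] by blast
    then obtain N where N: "open N" "l \<in> N" "\<And>t. t \<in> N \<Longrightarrow> V t \<noteq> 0 \<and> \<psi> t = pt (V t)"
      unfolding proj_lift_def by blast
    let ?w = "\<lambda>k. a (s k) + c (s k) * t"
    have evN: "\<forall>\<^sub>F k in sequentially. ?w k \<in> N \<inter> ball 0 1"
      using topological_tendstoD[OF w, of "N \<inter> ball 0 1"] N lball by auto
    have "\<forall>\<^sub>F k in sequentially. (u k, V (?w k)) \<in> bicone S"
      using uv(4) evN
    proof eventually_elim
      case (elim k)
      then have "(F (s k) t, \<psi> (?w k)) \<in> S" using g(2)[of "?w k" "s k"] by (simp add: F_def)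
      then show ?case using elim N(3)[of "?w k"] by (simp add: mem_bicone)
    qed
    moreover have "(\<lambda>k. (u k, V (?w k))) \<longlonglongrightarrow> (v, V l)"
      by (intro tendsto_Pair uv(3) isCont_tendsto_compose[OF proj_lift_isCont[OF V] w])
    moreover have "(v, V l) \<in> bicone UNIV" using uv(1) N by (simp add: mem_bicone)
    ultimately have "(v, V l) \<in> bicone S" by (rule bizclosed_limit[OF S])
    then show "(f t, \<psi> l) \<in> S" using uv(2) N(2,3) by (simp add: mem_bicone)
  qed
  then show False using hyp[OF l(1)] f(1) nonconst unfolding brody_hyperbolic_def by blast
qed

lemma has_derivative_vec:
  fixes V :: "complex \<Rightarrow> complex^'n"
  assumes "\<And>i. ((\<lambda>t. V t $ i) has_field_derivative w $ i) (at z)"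
  shows "(V has_derivative (\<lambda>h. h *s w)) (at z)"
proof (subst has_derivative_componentwise_within, intro ballI)
  fix b :: "complex^'n" assume "b \<in> Basis"
  then obtain k u where b: "b = axis k u" by (auto simp: Basis_vec_def)
  have "((\<lambda>t. V t $ k) has_derivative (\<lambda>h. h * w $ k)) (at z)"
    using assms[of k] has_derivative_eq_rhs[OF _ ext[of "(*) (w $ k)" "\<lambda>h. h * w $ k", OF mult.commute]]
    unfolding has_field_derivative_def by blast
  then show "((\<lambda>t. V t \<bullet> b) has_derivative (\<lambda>h. (h *s w) \<bullet> b)) (at z)"
    unfolding b inner_axis by (simp, intro has_derivative_inner_left)
qed

text \<open>On \<open>B\<close>, holomorphy of \<open>\<phi>\<close> is given by functions
  \<open>G\<close> on the cone that represent \<open>\<phi>\<close> only over \<open>B\<close>. A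
  lift \<open>V\<close> of \<open>\<psi>\<close> takes values in that cone, so
  \<open>G (V t)\<close> lifts the composition.\<close>

lemma proj_holomorphic_on_compose:
  fixes \<phi> :: "'m::finite proj \<Rightarrow> 'n::finite proj"
  assumes \<phi>: "map_holomorphic_on \<phi> B" and \<psi>: "proj_holomorphic_on \<psi> S" and "open S" "\<psi> ` S \<subseteq> B"
  shows "proj_holomorphic_on (\<phi> \<circ> \<psi>) S"
  unfolding proj_holomorphic_on_open[OF \<open>open S\<close>]
proof
  fix z assume z: "z \<in> S"
  obtain V where V: "proj_lift \<psi> z V" using \<psi> z proj_holomorphic_on_open[OF \<open>open S\<close>] by blast
  then obtain N where N: "open N" "z \<in> N" "vec_holomorphic_on V N" "\<And>t. t \<in> N \<Longrightarrow> V t \<noteq> 0 \<and> \<psi> t = pt (V t)"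
    unfolding proj_lift_def by blast
  have cone: "V t \<in> pcone B" if "t \<in> N \<inter> S" for t
  proof -
    have "\<psi> t \<in> B" using that assms(4) by blast
    then show ?thesis using N(4)[of t] that by (simp add: pcone_def)
  qed
  then have "V z \<in> pcone B" using z N(2) by blast
  then obtain N' and G :: "complex^'m \<Rightarrow> complex^'n" where G: "open N'" "V z \<in> N'" "\<And>i. mv_holomorphic_on (\<lambda>y. G y $ i) N'"
      "\<And>y. y \<in> N' \<Longrightarrow> G y \<noteq> 0" "\<And>y. y \<in> N' \<inter> pcone B \<Longrightarrow> \<phi> (pt y) = pt (G y)"
    using \<phi> unfolding map_holomorphic_on_def by metis
  have dV: "(V has_derivative (\<lambda>h. h *s vderiv V t)) (at t)" if "t \<in> N" for t
    using N(1,3) that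
    by (intro has_derivative_vec) (auto simp: vderiv_def vec_holomorphic_on_def intro!: holomorphic_derivI[of _ N])
  then have "continuous_on N V"
    by (intro continuous_at_imp_continuous_on) (blast intro: has_derivative_continuous)
  define M where "M = (N \<inter> V -` N') \<inter> S"
  have "open (N \<inter> V -` N')" using \<open>continuous_on N V\<close> N(1) G(1) by (rule continuous_open_preimage)
  then have "open M" using \<open>open S\<close> by (auto simp: M_def)
  have "vec_holomorphic_on (\<lambda>t. G (V t)) M"
    unfolding vec_holomorphic_on_def holomorphic_on_open[OF \<open>open M\<close>]
  proof (intro allI ballI)
    fix i t assume t: "t \<in> M"
    then obtain g' where g': "((\<lambda>y. G y $ i) has_derivative g') (at (V t))" "\<And>c w. g' (c *s w) = c * g' w"
      using G(3)[of i] unfolding mv_holomorphic_on_def M_def by blast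
    have "((\<lambda>t. G (V t) $ i) has_derivative (\<lambda>h. g' (h *s vderiv V t))) (at t)"
      using has_derivative_compose[OF dV g'(1)] t by (simp add: M_def)
    \<comment> \<open>Complex homogeneity of \<open>g'\<close> turns the real derivative into
      multiplication by a complex number.\<close>
    then have "((\<lambda>t. G (V t) $ i) has_field_derivative g' (vderiv V t)) (at t)"
      unfolding has_field_derivative_def by (rule has_derivative_eq_rhs) (simp add: g'(2) fun_eq_iff mult.commute)
    then show "\<exists>f'. ((\<lambda>t. G (V t) $ i) has_field_derivative f') (at t)" by blast
  qed
  moreover have "G (V t) \<noteq> 0 \<and> (\<phi> \<circ> \<psi>) t = pt (G (V t))" if "t \<in> M" for t
    using that G(4)[of "V t"] G(5)[of "V t"] N(4)[of t] cone[of t] by (simp add: M_def)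
  moreover have "z \<in> M" using z N(2) G(2) by (simp add: M_def)
  ultimately have "proj_lift (\<phi> \<circ> \<psi>) z (\<lambda>t. G (V t))"
    unfolding proj_lift_def using \<open>open M\<close> by blast
  then show "\<exists>G. proj_lift (\<phi> \<circ> \<psi>) z G" by blast
qed

text \<open>The set is the image of \<open>T\<close> under the inverse chart, evaluated on the
  compact set of unit vectors over \<open>T\<close>. Continuity holds because the inverse chart
  extends locally to a holomorphic function on the cone.\<close>

lemma compact_chart_preimage:
  assumes "disc_chart B \<psi>" "closed T" "T \<subseteq> \<psi> ` ball 0 1"
  shows "compact {z \<in> ball 0 1. \<psi> z \<in> T}"
proof -
  let ?g = "inv_into (ball 0 1) \<psi>"
  let ?V = "{v. norm v = 1 \<and> pt v \<in> T}"
  have inj: "inj_on \<psi> (ball 0 1)" and hol: "fun_holomorphic_on ?g (\<psi> ` ball 0 1)"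
    using assms(1) by (auto simp: disc_chart_def)
  have "continuous_on ?V (\<lambda>v. ?g (pt v))"
    unfolding continuous_on_eq_continuous_within
  proof
    fix v assume v: "v \<in> ?V"
    have sub: "?V \<subseteq> pcone (\<psi> ` ball 0 1)" using assms(3) by (auto simp: pcone_def)
    then obtain N h where N: "open N" "v \<in> N" "mv_holomorphic_on h N" "\<forall>y\<in>N \<inter> pcone (\<psi> ` ball 0 1). ?g (pt y) = h y"
      using hol v unfolding fun_holomorphic_on_def by blast
    have "isCont h v" using N(2,3) unfolding mv_holomorphic_on_def using has_derivative_continuous by blast
    then have c: "continuous (at v within ?V) h" by (rule continuous_at_imp_continuous_at_within)
    obtain d where d: "0 < d" "ball v d \<subseteq> N" using N(1,2) open_contains_ball by blast
    show "continuous (at v within ?V) (\<lambda>v. ?g (pt v))"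
    proof (rule continuous_transform_within[OF c d(1) v])
      fix y assume "y \<in> ?V" "dist y v < d"
      then have "y \<in> N \<inter> pcone (\<psi> ` ball 0 1)" using d(2) sub by (auto simp: dist_commute)
      then show "h y = ?g (pt y)" using N(4) by simp
    qed
  qed
  then have "compact ((\<lambda>v. ?g (pt v)) ` ?V)"
    by (intro compact_continuous_image compact_unit_cone assms)
  moreover have "(\<lambda>v. ?g (pt v)) ` ?V = {z \<in> ball 0 1. \<psi> z \<in> T}"
  proof (intro equalityI subsetI)
    fix z assume "z \<in> (\<lambda>v. ?g (pt v)) ` ?V"
    then obtain v where v: "pt v \<in> T" "z = ?g (pt v)" by blast
    then have "pt v \<in> \<psi> ` ball 0 1" using assms(3) by blast
    then show "z \<in> {z \<in> ball 0 1. \<psi> z \<in> T}"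
      using v inv_into_into[of "pt v" \<psi> "ball 0 1"] f_inv_into_f[of "pt v" \<psi> "ball 0 1"] by simp
  next
    fix z assume z: "z \<in> {z \<in> ball 0 1. \<psi> z \<in> T}"
    obtain v where v: "norm v = 1" "\<psi> z = pt v" using pt_surj_unit by blast
    then have "z = ?g (pt v)" using z inv_into_f_f[OF inj, of z] by simp
    then show "z \<in> (\<lambda>v. ?g (pt v)) ` ?V" using v z by auto
  qed
  ultimately show ?thesis by simp
qed

text \<open>A non-integrable density has integral 0, which is harmless for an upper bound.\<close>

lemma set_integral_le_const:
  fixes f :: "complex \<Rightarrow> real"
  assumes "\<And>z. z \<in> A \<Longrightarrow> f z \<le> C" "A \<subseteq> ball 0 1" "0 \<le> C"
  shows "(LINT z:A|lborel. f z) \<le> C * measure lborel (ball (0::complex) 1)"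
proof (cases "integrable lborel (\<lambda>z. indicator A z *\<^sub>R f z)")
  case True
  have i: "integrable lborel (\<lambda>z. C * indicator (ball (0::complex) 1) z)"
    using emeasure_lborel_ball_finite by (intro integrable_mult_right integrable_real_indicator) auto
  have "(LINT z:A|lborel. f z) \<le> (LINT z|lborel. C * indicator (ball (0::complex) 1) z)"
    unfolding set_lebesgue_integral_def
  proof (rule integral_mono[OF True i])
    show "indicator A z *\<^sub>R f z \<le> C * indicator (ball 0 1) z" for z
      using assms by (auto simp: indicator_def)
  qed
  also have "\<dots> = C * measure lborel (ball (0::complex) 1)" by simp
  finally show ?thesis .
next
  case False
  then show ?thesis
    using assms(3) by (simp add: set_lebesgue_integral_def not_integrable_integral_eq)
qed

section \<open>Pull-back densities along lifted curves\<close>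

lemma hol_lift_exists:
  assumes "open S" "z \<in> S" "proj_holomorphic_on (fst \<circ> \<gamma>) S" "proj_holomorphic_on (snd \<circ> \<gamma>) S"
  shows "\<exists>G. hol_lift \<gamma> z G"
proof -
  obtain U V where "proj_lift (fst \<circ> \<gamma>) z U" "proj_lift (snd \<circ> \<gamma>) z V"
    using assms unfolding proj_holomorphic_on_open[OF assms(1)] by blast
  then obtain N N' where N: "open N" "z \<in> N" "vec_holomorphic_on U N" "\<And>t. t \<in> N \<Longrightarrow> U t \<noteq> 0 \<and> (fst \<circ> \<gamma>) t = pt (U t)"
    and N': "open N'" "z \<in> N'" "vec_holomorphic_on V N'" "\<And>t. t \<in> N' \<Longrightarrow> V t \<noteq> 0 \<and> (snd \<circ> \<gamma>) t = pt (V t)"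
    unfolding proj_lift_def by metis
  have "hol_lift \<gamma> z (\<lambda>t. (U t, V t))"
    unfolding hol_lift_def
  proof (intro exI[of _ "N \<inter> N'"] conjI ballI)
    show "vec_holomorphic_on (fst \<circ> (\<lambda>t. (U t, V t))) (N \<inter> N')"
      using N(3) holomorphic_on_subset[OF _ Int_lower1] by (simp add: vec_holomorphic_on_def o_def)
    show "vec_holomorphic_on (snd \<circ> (\<lambda>t. (U t, V t))) (N \<inter> N')"
      using N'(3) holomorphic_on_subset[OF _ Int_lower2] by (simp add: vec_holomorphic_on_def o_def)
    fix t assume "t \<in> N \<inter> N'"
    then show "fst (U t, V t) \<noteq> 0" "snd (U t, V t) \<noteq> 0" "\<gamma> t = bipt (U t, V t)"
      using N(4)[of t] N'(4)[of t] by (simp_all add: bipt_def prod_eq_iff)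
  qed (use N N' in auto)
  then show ?thesis by blast
qed

lemma hol_lift_imp_proj_lift:
  assumes "hol_lift \<gamma> z G"
  shows "proj_lift (fst \<circ> \<gamma>) z (fst \<circ> G)" "proj_lift (snd \<circ> \<gamma>) z (snd \<circ> G)"
proof -
  obtain N where N: "open N" "z \<in> N" "vec_holomorphic_on (fst \<circ> G) N" "vec_holomorphic_on (snd \<circ> G) N"
      "\<And>t. t \<in> N \<Longrightarrow> fst (G t) \<noteq> 0 \<and> snd (G t) \<noteq> 0 \<and> \<gamma> t = bipt (G t)"
    using assms unfolding hol_lift_def by blast
  then show "proj_lift (fst \<circ> \<gamma>) z (fst \<circ> G)" "proj_lift (snd \<circ> \<gamma>) z (snd \<circ> G)"
    unfolding proj_lift_def by (intro exI[of _ N]; simp add: bipt_def)+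
qed

text \<open>The lift inside \<open>pullback_density\<close> is an unspecified choice, but the bound
  is in terms of speeds, which every lift computes alike.\<close>

lemma pullback_density_bound:
  assumes \<Omega>: "\<And>y w. y \<in> bicone Q \<Longrightarrow> norm (\<Omega> y w (biscale \<i> \<i> w)) \<le>
      C * ((fs_norm (fst y) (fst w))\<^sup>2 + (fs_norm (snd y) (snd w))\<^sup>2)"
    and "\<exists>G. hol_lift \<gamma> z G" "\<gamma> z \<in> Q"
  shows "norm (pullback_density \<Omega> \<gamma> z) \<le> C * ((proj_speed (fst \<circ> \<gamma>) z)\<^sup>2 + (proj_speed (snd \<circ> \<gamma>) z)\<^sup>2)"
proof -
  define G where "G = (SOME G. hol_lift \<gamma> z G)"
  have G: "hol_lift \<gamma> z G" unfolding G_def using assms(2) by (rule someI_ex)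
  define w where "w = (vderiv (fst \<circ> G) z, vderiv (snd \<circ> G) z)"
  have "pullback_density \<Omega> \<gamma> z = \<Omega> (G z) w (biscale \<i> \<i> w)"
    by (simp add: pullback_density_def Let_def w_def vderiv_def flip: G_def)
  moreover have "G z \<in> bicone Q"
    using G assms(3) unfolding hol_lift_def bicone_def by auto
  ultimately show ?thesis
    using \<Omega>[of "G z" w] proj_speed_eq[OF hol_lift_imp_proj_lift(1)[OF G]] proj_speed_eq[OF hol_lift_imp_proj_lift(2)[OF G]]
    by (simp add: w_def)
qed

lemma proj_holomorphic_on_cong:
  assumes "\<And>t. t \<in> S \<Longrightarrow> f t = g t" "proj_holomorphic_on f S"
  shows "proj_holomorphic_on g S"
  unfolding proj_holomorphic_on_def
proof
  fix z assume "z \<in> S"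
  then obtain N G where "open N" "z \<in> N" "vec_holomorphic_on G N" "\<forall>t\<in>N. G t \<noteq> 0" "\<forall>t\<in>N \<inter> S. f t = pt (G t)"
    using assms(2) unfolding proj_holomorphic_on_def by blast
  then show "\<exists>N G. open N \<and> z \<in> N \<and> vec_holomorphic_on G N \<and> (\<forall>t\<in>N. G t \<noteq> 0) \<and> (\<forall>t\<in>N \<inter> S. g t = pt (G t))"
    using assms(1) by (intro exI[of _ N] exI[of _ G]) simp
qed

text \<open>The chart and the extension cover chosen by \<open>SOME\<close> depend on
  \<open>B\<close>, \<open>S\<close>, \<open>D\<close> and \<open>\<omega>\<close> but not on
  \<open>x\<close>, so one set of constants serves all sections. The chart \<open>\<psi>0\<close>
  only witnesses that the choice succeeds.\<close>

lemma height_integral_bounded: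
  fixes B D :: "'m::finite proj set" and S :: "('n::finite proj \<times> 'm proj) set"
  assumes S: "bizclosed S"
    and chart: "disc_chart B \<psi>0" "closure D \<subseteq> \<psi>0 ` ball 0 1"
    and W: "openin (top_of_set S) W" "{q \<in> S. snd q \<in> closure D} \<subseteq> W" and \<omega>: "real_11_form_on S W \<omega>"
    and hyp: "\<forall>b\<in>closure D. brody_hyperbolic {p. (p, b) \<in> S}"
  shows "\<exists>K. \<forall>x. holomorphic_section B S x \<longrightarrow> height_integral B S D \<omega> x \<le> K"
proof -
  define \<psi> where "\<psi> = (SOME \<psi>. disc_chart B \<psi> \<and> closure D \<subseteq> \<psi> ` ball 0 1)"
  have "disc_chart B \<psi> \<and> closure D \<subseteq> \<psi> ` ball 0 1"
    unfolding \<psi>_def by (rule someI[of _ \<psi>0]) (use chart in blast)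
  then have \<psi>: "disc_chart B \<psi>" "closure D \<subseteq> \<psi> ` ball 0 1" by auto
  then have \<psi>hol: "proj_holomorphic_on \<psi> (ball 0 1)" by (simp add: disc_chart_def)
  have \<psi>B: "\<psi> ` ball 0 1 \<subseteq> B"
    by (rule openin_imp_subset[of euclidean]) (use \<psi>(1) in \<open>simp add: disc_chart_def\<close>)
  define C where "C = {q \<in> S. snd q \<in> closure D}"
  define L where "L = (SOME L. extension_cover S C \<omega> L)"
  have "compact C" unfolding C_def using S by (intro compact_fibres) auto
  then have "\<exists>L. extension_cover S C \<omega> L"
    using extension_cover_exists[OF W(1) _ _ \<omega>] W(2) by (simp add: C_def)
  then have L: "extension_cover S C \<omega> L" unfolding L_def by (rule someI_ex)
  define K where "K = {z \<in> ball 0 1. \<psi> z \<in> closure D}"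
  have K: "compact K" "K \<subseteq> ball 0 1"
    unfolding K_def using compact_chart_preimage[OF \<psi>(1) _ \<psi>(2)] by auto
  obtain M where M: "\<And>g z. proj_holomorphic_on g (ball 0 1) \<Longrightarrow> (\<And>z. z \<in> ball 0 1 \<Longrightarrow> (g z, \<psi> z) \<in> S) \<Longrightarrow>
      z \<in> K \<Longrightarrow> proj_speed g z \<le> M"
    using bounded_speed_of_sections[OF S \<psi>hol K] hyp unfolding K_def by blast
  have "bounded (proj_speed \<psi> ` K)"
    using continuous_on_subset[OF continuous_on_proj_speed[OF open_ball \<psi>hol] K(2)] K(1)
    by (intro compact_imp_bounded compact_continuous_image)
  then obtain M' where "\<forall>v\<in>proj_speed \<psi> ` K. norm v \<le> M'" unfolding bounded_iff by blast
  then have M': "proj_speed \<psi> z \<le> M'" if "z \<in> K" for z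
    using that abs_le_D1[of "proj_speed \<psi> z" M'] unfolding real_norm_def by blast
  have "\<forall>a\<in>set L. \<exists>c. \<forall>y\<in>bicone (fst a). \<forall>w. norm (snd a y w (biscale \<i> \<i> w)) \<le>
      c * ((fs_norm (fst y) (fst w))\<^sup>2 + (fs_norm (snd y) (snd w))\<^sup>2)"
  proof
    fix a assume "a \<in> set L"
    then have "compact (fst a) \<and> (\<exists>U. fst a \<subseteq> U \<and> smooth_11_form U (snd a) \<and> extends_form S U (snd a) \<omega>)"
      using bspec[OF conjunct1[OF L[unfolded extension_cover_def]]] by (simp add: case_prod_beta)
    then obtain U where "compact (fst a)" "fst a \<subseteq> U" "smooth_11_form U (snd a)" by blast
    then show "\<exists>c. \<forall>y\<in>bicone (fst a). \<forall>w. norm (snd a y w (biscale \<i> \<i> w)) \<le>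
      c * ((fs_norm (fst y) (fst w))\<^sup>2 + (fs_norm (snd y) (snd w))\<^sup>2)"
      by (intro smooth_11_form_bound)
  qed
  from bchoice[OF this] obtain c where c: "\<forall>a\<in>set L. \<forall>y\<in>bicone (fst a). \<forall>w. norm (snd a y w (biscale \<i> \<i> w)) \<le>
      c a * ((fs_norm (fst y) (fst w))\<^sup>2 + (fs_norm (snd y) (snd w))\<^sup>2)"
    by (elim exE)
  define C0 where "C0 = (\<Sum>a\<in>set L. \<bar>c a\<bar>)"
  define C1 where "C1 = C0 * (M\<^sup>2 + M'\<^sup>2)"
  have C0: "0 \<le> C0" by (simp add: C0_def sum_nonneg)
  then have C1: "0 \<le> C1" by (simp add: C1_def)
  have "height_integral B S D \<omega> x \<le> C1 * measure lborel (ball (0::complex) 1)" if x: "holomorphic_section B S x" for x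
  proof -
    have xS: "x b \<in> S" "snd (x b) = b" if "b \<in> B" for b using x that by (auto simp: holomorphic_section_def)
    have x\<psi>: "x (\<psi> t) \<in> S" "snd (x (\<psi> t)) = \<psi> t" if "t \<in> ball 0 1" for t
      using xS[of "\<psi> t"] \<psi>B that by blast+
    have hol1: "proj_holomorphic_on (fst \<circ> (x \<circ> \<psi>)) (ball 0 1)"
      unfolding o_assoc by (rule proj_holomorphic_on_compose[OF _ \<psi>hol open_ball \<psi>B])
         (use x in \<open>simp add: holomorphic_section_def\<close>)
    have hol2: "proj_holomorphic_on (snd \<circ> (x \<circ> \<psi>)) (ball 0 1)"
      by (rule proj_holomorphic_on_cong[OF _ \<psi>hol]) (use x\<psi>(2) in simp)
    have "Re (pullback_density (extension_at S C \<omega> (x (\<psi> z))) (x \<circ> \<psi>) z) \<le> C1"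
      if z: "z \<in> ball 0 1" "\<psi> z \<in> D" for z
    proof -
      have zK: "z \<in> K" using z closure_subset by (auto simp: K_def)
      have "x (\<psi> z) \<in> C" using x\<psi>[OF z(1)] z(2) closure_subset by (auto simp: C_def)
      then have "x (\<psi> z) \<in> (\<Union>(Q, \<Omega>)\<in>set L. Q)"
        by (rule subsetD[OF conjunct2[OF L[unfolded extension_cover_def]]])
      then have "filter (\<lambda>(Q, \<Omega>). x (\<psi> z) \<in> Q) L \<noteq> []" by (auto simp: filter_empty_conv)
      define a where "a = hd (filter (\<lambda>(Q, \<Omega>). x (\<psi> z) \<in> Q) L)"
      have "a \<in> set (filter (\<lambda>(Q, \<Omega>). x (\<psi> z) \<in> Q) L)"
        unfolding a_def by (rule hd_in_set) fact
      then have a: "a \<in> set L" "(x \<circ> \<psi>) z \<in> fst a" by auto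
      have ext: "extension_at S C \<omega> (x (\<psi> z)) = snd a" by (simp add: extension_at_def a_def L_def)
      have lift: "\<exists>G. hol_lift (x \<circ> \<psi>) z G" by (rule hol_lift_exists[OF open_ball z(1) hol1 hol2])
      have sp1: "proj_speed (fst \<circ> (x \<circ> \<psi>)) z \<le> M"
      proof (rule M[OF hol1 _ zK])
        show "((fst \<circ> (x \<circ> \<psi>)) t, \<psi> t) \<in> S" if "t \<in> ball 0 1" for t
          using x\<psi>[OF that] by (metis comp_apply prod.collapse)
      qed
      \<comment> \<open>The base component of every section is the chart itself, whose speed is
        bounded on \<open>K\<close> by continuity; hyperbolicity enters only for the fibre
        component.\<close>
      have sp2: "proj_speed (snd \<circ> (x \<circ> \<psi>)) z \<le> M'"
      proof -
        obtain V where V: "proj_lift \<psi> z V" using \<psi>hol z(1) unfolding proj_holomorphic_on_open[OF open_ball] by blast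
        then obtain N where N: "open N" "z \<in> N" "vec_holomorphic_on V N" "\<And>t. t \<in> N \<Longrightarrow> V t \<noteq> 0 \<and> \<psi> t = pt (V t)"
          unfolding proj_lift_def by blast
        have "proj_lift (snd \<circ> (x \<circ> \<psi>)) z V"
          unfolding proj_lift_def
        proof (intro exI[of _ "N \<inter> ball 0 1"] conjI ballI)
          show "vec_holomorphic_on V (N \<inter> ball 0 1)"
            using N(3) holomorphic_on_subset[OF _ Int_lower1] by (simp add: vec_holomorphic_on_def)
          fix t assume "t \<in> N \<inter> ball 0 1"
          then show "V t \<noteq> 0" "(snd \<circ> (x \<circ> \<psi>)) t = pt (V t)" using N(4)[of t] x\<psi>(2)[of t] by auto
        qed (use N z in auto)
        then have "proj_speed (snd \<circ> (x \<circ> \<psi>)) z = proj_speed \<psi> z" using proj_speed_eq V by metis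
        then show ?thesis using M'[OF zK] by simp
      qed
      have "Re (pullback_density (snd a) (x \<circ> \<psi>) z) \<le> norm (pullback_density (snd a) (x \<circ> \<psi>) z)"
        by (rule complex_Re_le_cmod)
      also have "\<dots> \<le> c a * ((proj_speed (fst \<circ> (x \<circ> \<psi>)) z)\<^sup>2 + (proj_speed (snd \<circ> (x \<circ> \<psi>)) z)\<^sup>2)"
        by (rule pullback_density_bound[of "fst a", OF _ lift a(2)])
           (rule bspec[OF bspec[OF c a(1)], THEN spec])
      also have "\<dots> \<le> C0 * (M\<^sup>2 + M'\<^sup>2)"
      proof (rule mult_mono)
        have "\<bar>c a\<bar> \<le> C0" unfolding C0_def using a(1) by (intro member_le_sum) auto
        then show "c a \<le> C0" by linarith
        show "(proj_speed (fst \<circ> (x \<circ> \<psi>)) z)\<^sup>2 + (proj_speed (snd \<circ> (x \<circ> \<psi>)) z)\<^sup>2 \<le> M\<^sup>2 + M'\<^sup>2"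
          using sp1 sp2 by (intro add_mono power_mono proj_speed_nonneg)
      qed (use C0 in auto)
      finally show ?thesis unfolding ext C1_def .
    qed
    then show ?thesis
      unfolding height_integral_def Let_def \<psi>_def[symmetric] C_def[symmetric]
      by (intro set_integral_le_const C1) auto
  qed
  then show ?thesis by blast
qed

theorem theorem2p7:
  fixes B D D' :: "'m::finite proj set"
    and X :: "(('n::finite \<Rightarrow> nat) \<Rightarrow> ('m proj \<Rightarrow> complex) set) set"
    and \<X> W :: "('n proj \<times> 'm proj) set"
    and \<omega> :: "('n, 'm) two_form"
  assumes "smooth_projective_curve B"
    and "projective_variety (function_field B) X"
    and "integral_model B X \<X>"
    and "openin (top_of_set B) D"
    and "open_disc B D'"
    and "closure D \<subseteq> D'"
    and "openin (top_of_set \<X>) W"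
    and "{q \<in> \<X>. snd q \<in> closure D} \<subseteq> W"
    and "real_11_form_on \<X> W \<omega>"
    and "\<forall>b\<in>closure D. brody_hyperbolic {p. (p, b) \<in> \<X>}"
  shows "bdd_above (partial_height B \<X> D \<omega> ` rational_points (function_field B) X)"
proof -
  have "bizclosed \<X>" using assms(3) by (simp add: integral_model_def)
  moreover obtain \<psi> where "disc_chart B \<psi>" "closure D \<subseteq> \<psi> ` ball 0 1"
    using assms(5,6) by (auto simp: open_disc_def)
  ultimately obtain K where K: "\<And>x. holomorphic_section B \<X> x \<Longrightarrow> height_integral B \<X> D \<omega> x \<le> K"
    using height_integral_bounded[of \<X> B \<psi> D W \<omega>] assms(7-10) by blast
  \<comment> \<open>The second entry is the height of the value that \<open>SOME\<close> returns for
    an empty predicate, which \<open>section_of_point\<close> takes whenever no section has the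
    required properties.\<close>
  let ?K = "max K (height_integral B \<X> D \<omega> (SOME x. False))"
  have "partial_height B \<X> D \<omega> \<Xi> \<le> ?K" for \<Xi>
  proof -
    define P where "P x \<longleftrightarrow> holomorphic_section B \<X> x \<and>
     (\<exists>\<xi>\<in>\<Xi>. \<exists>f Z. (\<forall>i. f i \<in> \<xi> i) \<and> zclosed Z \<and> \<not> B \<subseteq> Z \<and>
       (\<forall>b\<in>B - Z. (\<chi> i. f i b) \<noteq> 0 \<and> x b = (pt (\<chi> i. f i b), b)))" for x
    have sec: "section_of_point B \<X> \<Xi> = (SOME x. P x)"
      unfolding section_of_point_def P_def ..
    show ?thesis
    proof (cases "\<exists>x. P x")
      case True
      then have "P (section_of_point B \<X> \<Xi>)" unfolding sec by (rule someI_ex)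
      then show ?thesis using K unfolding partial_height_def P_def by (simp add: le_max_iff_disj)
    next
      case False
      \<comment> \<open>Then the section chosen by \<open>SOME\<close> is a junk value that does not depend on the point.\<close>
      then have "P = (\<lambda>_. False)" by auto
      then show ?thesis unfolding partial_height_def sec by simp
    qed
  qed
  then show ?thesis by (intro bdd_aboveI2)
qed

end
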